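(* Let $n>1$ be an integer, $1<p<q<\infty$, $\mu>0$, $0\le\frac1p-\frac1q\le\frac1n$ and $\eta>0$. Let $w\in W(\mathbf{R}_+)$. If $\lim_{\rho\to+0}H(\rho)=0$, then the inequality $$\int_{B_\eta}|\nabla u|^p\, w(|x|)^{p-1}|x|^{1-n}\,dx\;\ge\; C\left(\int_{B_\eta}\frac{|u|^q\,|x|^{1-n}}{w(|x|)\,f_\eta(|x|)^{1+q/p'}}\,dx\right)^{p/q}\qquad\text{for all }u\in C_c^\infty(B_\eta\setminus\{0\})$$ is not valid; that is, there is no positive constant $C$ for which it holds.
   Context: Notation: $\mathbf{R}_+=(0,\infty)$, $p'=p/(p-1)$, and $B_\eta=\{x\in\mathbf{R}^n:|x|<\eta\}$. Weight classes: $$W(\mathbf{R}_+)=\{w\in C^1(\mathbf{R}_+): w>0,\ \lim_{t\to+0}w(t)=a\text{ for some }a\in[0,\infty]\},$$ $$P(\mathbf{R}_+)=\{w\in W(\mathbf{R}_+): w^{-1}\notin L^1((0,\eta))\text{ for some }\eta>0\},$$ $$Q(\mathbf{R}_+)=\{w\in W(\mathbf{R}_+): w^{-1}\in L^1((0,\eta))\text{ for any }\eta>0\}.$$ Here $w^{-1}=1/w$. $W(\mathbf{R}_+)$ is the disjoint union of $P(\mathbf{R}_+)$ and $Q(\mathbf{R}_+)$. For fixed $\mu>0$, $\eta>0$, the function $f_\eta$ is $$f_\eta(t)=\mu+\int_t^\eta\frac{ds}{w(s)}\ \text{ if } w\in P(\mathbf{R}_+),\qquad f_\eta(t)=\int_0^t\frac{ds}{w(s)}\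 \text{ if } w\in Q(\mathbf{R}_+).$$ The strictly increasing function $\varphi$ is defined as follows. If $w\in P(\mathbf{R}_+)$, $\varphi(\rho)$ is the unique solution of $\rho^{-1}=\mu+\int_{\varphi(\rho)}^{\eta}\frac{ds}{w(s)}$; if $w\in Q(\mathbf{R}_+)$, $\varphi(\rho)$ is the unique solution of $\rho=\int_0^{\varphi(\rho)}\frac{ds}{w(s)}$. Thus $\varphi^{-1}(t)=1/(\mu+\int_t^\eta\frac{ds}{w(s)})$ for $w\in P(\mathbf{R}_+)$ and $\varphi^{-1}(t)=\int_0^t\frac{ds}{w(s)}$ for $w\in Q(\mathbf{R}_+)$, for $0<t\le\eta$. For $0<\rho<\varphi^{-1}(\eta)$, $$H(\rho)=\frac{\rho\,\varphi'(\rho)}{\varphi(\rho)}=\frac{w(\varphi(\rho))}{\varphi(\rho)}\,f_\eta(\varphi(\rho)).$$ *)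

theory Defs
  imports "HOL-Analysis.Analysis"
begin

text \<open>
  The open half-line \<open>(0, \<infinity>)\<close> is \<open>{0<..}\<close>. A weight is a total function on the reals of which
  only the values on \<open>{0<..}\<close> are ever used.
\<close>

definition weights :: "(real \<Rightarrow> real) set"
  where "weights = {w. w C1_differentiable_on {0<..} \<and> (\<forall>t>0. w t > 0) \<and>
           (\<exists>a::ennreal. ((\<lambda>t. ennreal (w t)) \<longlongrightarrow> a) (at_right 0))}"

definition weights_P :: "(real \<Rightarrow> real) set"
  where "weights_P = {w \<in> weights. \<exists>\<eta>>0. \<not> set_integrable lborel {0<..<\<eta>} (\<lambda>s. 1 / w s)}"

definition weights_Q :: "(real \<Rightarrow> real) set"
  where "weights_Q = {w \<in> weights. \<forall>\<eta>>0. set_integrable lborel {0<..<\<eta>} (\<lambda>s. 1 / w s)}"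

text \<open>
  On \<open>weights\<close>, which is the disjoint union of \<open>weights_P\<close> and \<open>weights_Q\<close>, the
  \<open>else\<close> branches below are the case \<open>w \<in> weights_Q\<close>.
\<close>

definition f_eta :: "real \<Rightarrow> real \<Rightarrow> (real \<Rightarrow> real) \<Rightarrow> real \<Rightarrow> real"
  where "f_eta \<mu> \<eta> w t =
    (if w \<in> weights_P then \<mu> + (LBINT s=t..\<eta>. 1 / w s) else (LBINT s=0..t. 1 / w s))"

text \<open>
  \<open>phi \<mu> \<eta> w \<rho>\<close> is only meaningful for \<open>0 < \<rho> \<le> \<phi>\<^sup>-\<^sup>1(\<eta>)\<close>, that is \<open>\<rho> \<le> 1 / \<mu>\<close> for
  \<open>w \<in> weights_P\<close> and \<open>\<rho> \<le> f_eta \<mu> \<eta> w \<eta>\<close> for \<open>w \<in> weights_Q\<close>; for such \<open>\<rho>\<close> the equation has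
  exactly one solution in \<open>{0<..\<eta>}\<close>.
\<close>

definition phi :: "real \<Rightarrow> real \<Rightarrow> (real \<Rightarrow> real) \<Rightarrow> real \<Rightarrow> real"
  where "phi \<mu> \<eta> w \<rho> = (THE t. t \<in> {0<..\<eta>} \<and>
    (if w \<in> weights_P then 1 / \<rho> = \<mu> + (LBINT s=t..\<eta>. 1 / w s)
     else \<rho> = (LBINT s=0..t. 1 / w s)))"

definition H :: "real \<Rightarrow> real \<Rightarrow> (real \<Rightarrow> real) \<Rightarrow> real \<Rightarrow> real"
  where "H \<mu> \<eta> w \<rho> = \<rho> * deriv (phi \<mu> \<eta> w) \<rho> / phi \<mu> \<eta> w \<rho>"

primrec Ck :: "nat \<Rightarrow> ('a::real_normed_vector \<Rightarrow> real) \<Rightarrow> bool"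
  where
    "Ck 0 u \<longleftrightarrow> continuous_on UNIV u"
  | "Ck (Suc k) u \<longleftrightarrow>
       (\<forall>x. u differentiable (at x)) \<and> (\<forall>v. Ck k (\<lambda>x. frechet_derivative u (at x) v))"

text \<open>
  Elements of \<open>C\<^sub>c\<^sup>\<infinity>(\<Omega>)\<close> are identified with their extension by zero to the whole space.
\<close>

definition test_functions :: "'a::real_normed_vector set \<Rightarrow> ('a \<Rightarrow> real) set"
  where "test_functions \<Omega> =
    {u. (\<forall>k. Ck k u) \<and> compact (closure {x. u x \<noteq> 0}) \<and> closure {x. u x \<noteq> 0} \<subseteq> \<Omega>}"

definition gradient :: "('a::real_inner \<Rightarrow> real) \<Rightarrow> 'a \<Rightarrow> 'a"
  where "gradient u x = (THE D. GDERIV u x :> D)"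

end

theory Submission
  imports Defs
begin

text \<open>
  Write \<open>f\<close> for \<open>f_eta\<close>, \<open>N\<close> for the dimension and \<open>1/p + 1/p' = 1\<close>. For \<open>t = phi \<rho>\<close> one has
  \<open>H \<rho> = w t * f t / t\<close>, so the hypothesis says that the length scale \<open>w f\<close>, on which \<open>f\<close> varies by a
  constant factor, is small compared to the radius near the origin (\<open>H_phi_inv\<close>,
  \<open>weight_small_if_H_tendsto_0\<close>). Functions may therefore be concentrated in a small angle at no
  extra cost: if \<open>w f \<le> \<epsilon> r\<close>, take \<open>u\<close> to be the product of a bump in the variable \<open>f\<close>, supported in an
  interval \<open>a \<le> r \<le> b\<close> where \<open>F \<le> f \<le> 2 F\<close> (\<open>doubling_interval\<close>), and of a cut-off at angular scale
  \<open>\<epsilon>\<close>. The derivative of the cut-off is of order \<open>1 / (\<epsilon> r) \<le> 1 / (w f)\<close>, which is the order of the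
  radial derivative. With \<open>\<kappa>\<close> the volume of a cone of opening \<open>\<epsilon>\<close>, the left side of the inequality is
  at most of order \<open>F powr (1 - p) * \<kappa>\<close>, and the integral on the right is at least of order
  \<open>F powr (- q / p') * \<kappa>\<close> (\<open>test_function_estimate\<close>). The powers of \<open>F\<close> cancel, and a constant \<open>C\<close>
  would have to satisfy \<open>C \<le> const * \<kappa> powr (1 - p / q)\<close>. But \<open>\<kappa>\<close> is of order \<open>\<epsilon> ^ (N - 1)\<close>
  (\<open>cone_vol_le\<close>, \<open>cone_vol_ge\<close>) and tends to 0 with \<open>\<epsilon>\<close>, as \<open>N > 1\<close> and \<open>p < q\<close>.

  Two points need care. The function \<open>f\<close> is only twice continuously differentiable, so the radial
  bump is composed with a polynomial in \<open>norm x ^ 2\<close> obtained by Weierstrass approximation of \<open>1 / w\<close>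
  (\<open>radial_profile\<close>). And the weight \<open>w\<close> may oscillate arbitrarily on the scale of the support, so the
  integrals cannot be estimated by suprema; they are reduced to \<open>\<integral> 1 / w\<close> by polar coordinates on a
  cone (\<open>distr_norm_cone\<close>, \<open>cone_annulus_integral\<close>), which follow from scaling alone.
\<close>

section \<open>Smooth functions\<close>

text \<open>Smoothness of a function of one real variable, witnessed by the whole sequence of its
  derivatives.\<close>

definition smooth :: "(real \<Rightarrow> real) \<Rightarrow> bool"
  where "smooth g \<longleftrightarrow> (\<exists>D. D 0 = g \<and> (\<forall>k x. (D k has_real_derivative D (Suc k) x) (at x)))"

lemma smoothD:
  assumes "smooth g"
  obtains g' where "smooth g'" "\<And>x. (g has_real_derivative g' x) (at x)"
proof -
  obtain D where D: "D 0 = g" "\<And>k x. (D k has_real_derivative D (Suc k) x) (at x)"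
    using assms unfolding smooth_def by auto
  have "smooth (D 1)"
    unfolding smooth_def by (rule exI[of _ "\<lambda>k. D (Suc k)"]) (use D in auto)
  moreover have "\<And>x. (g has_real_derivative D 1 x) (at x)" using D(2)[of 0] D(1) by auto
  ultimately show thesis using that by blast
qed

lemma smooth_imp_isCont: "smooth g \<Longrightarrow> isCont g x"
  by (metis smoothD DERIV_isCont)

lemma smooth_imp_continuous_on: "smooth g \<Longrightarrow> continuous_on S g"
  by (simp add: continuous_at_imp_continuous_on smooth_imp_isCont)

lemma smooth_poly: "smooth (poly p)"
  unfolding smooth_def
  by (rule exI[of _ "\<lambda>k. poly ((pderiv ^^ k) p)"]) (auto intro: poly_DERIV)

lemma Ck_imp_continuous_on: "Ck k u \<Longrightarrow> continuous_on UNIV u"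
  by (cases k)
    (auto simp: continuous_at_imp_continuous_on differentiable_imp_continuous_within)

text \<open>Only directional derivatives enter the recursion for \<open>Ck\<close>, so any family of Frechet derivatives
  with \<open>Ck k\<close> directional parts can be used.\<close>

lemma Ck_SucI:
  assumes "\<And>x. (u has_derivative u' x) (at x)" "\<And>v. Ck k (\<lambda>x. u' x v)"
  shows "Ck (Suc k) u"
proof -
  have "frechet_derivative u (at x) = u' x" for x
    using frechet_derivative_at[OF assms(1)] by simp
  then show ?thesis using assms by (auto simp: differentiable_def)
qed

lemma Ck_has_derivative:
  assumes "Ck (Suc k) u"
  shows "(u has_derivative frechet_derivative u (at x)) (at x)"
  using assms by (simp add: frechet_derivative_works)

lemma Ck_Suc_imp: "Ck (Suc k) u \<Longrightarrow> Ck k u"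
proof (induction k arbitrary: u)
  case 0
  then show ?case by (metis Ck.simps(1) Ck_imp_continuous_on)
next
  case (Suc k)
  then show ?case by auto
qed

lemma Ck_const: "Ck k (\<lambda>x. c)"
proof (induction k arbitrary: c)
  case (Suc k)
  show ?case by (rule Ck_SucI[where u' = "\<lambda>x v. 0"]) (auto simp: Suc)
qed auto

lemma Ck_add: "Ck k u \<Longrightarrow> Ck k v \<Longrightarrow> Ck k (\<lambda>x. u x + v x)"
proof (induction k arbitrary: u v)
  case 0
  then show ?case by (auto intro: continuous_on_add)
next
  case (Suc k)
  show ?case
    by (rule Ck_SucI[where u' = "\<lambda>x h. frechet_derivative u (at x) h + frechet_derivative v (at x) h"])
      (use Suc in \<open>auto intro!: has_derivative_add Ck_has_derivative\<close>)
qed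

lemma Ck_mult: "Ck k u \<Longrightarrow> Ck k v \<Longrightarrow> Ck k (\<lambda>x. u x * v x)"
proof (induction k arbitrary: u v)
  case 0
  then show ?case by (auto intro: continuous_on_mult)
next
  case (Suc k)
  have "Ck k u" "Ck k v" using Suc.prems Ck_Suc_imp by blast+
  show ?case
    by (rule Ck_SucI[where u' = "\<lambda>x h. u x * frechet_derivative v (at x) h + frechet_derivative u (at x) h * v x"])
      (use Suc \<open>Ck k u\<close> \<open>Ck k v\<close> in \<open>auto intro!: has_derivative_mult Ck_has_derivative Ck_add\<close>)
qed

lemma Ck_compose_smooth: "smooth g \<Longrightarrow> Ck k u \<Longrightarrow> Ck k (\<lambda>x. g (u x))"
proof (induction k arbitrary: u g)
  case 0
  then show ?case
    using continuous_on_compose2[OF smooth_imp_continuous_on[of g UNIV], of UNIV u] by auto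
next
  case (Suc k)
  obtain g' where g': "smooth g'" "\<And>x. (g has_real_derivative g' x) (at x)"
    using smoothD[OF Suc.prems(1)] by blast
  have "Ck k u" using Suc.prems Ck_Suc_imp by blast
  have d: "((\<lambda>x. g (u x)) has_derivative (\<lambda>h. g' (u x) * frechet_derivative u (at x) h)) (at x)" for x
    by (rule has_derivative_compose[OF Ck_has_derivative[OF Suc.prems(2)]
          g'(2)[unfolded has_field_derivative_def]])
  show ?case
    by (rule Ck_SucI[OF d]) (use Suc g' \<open>Ck k u\<close> in \<open>auto intro!: Ck_mult\<close>)
qed

lemma Ck_inner_left: "Ck k (\<lambda>x::'a::real_inner. x \<bullet> c)"
proof (cases k)
  case (Suc j)
  show ?thesis unfolding Suc
    by (rule Ck_SucI[where u' = "\<lambda>x h. h \<bullet> c"])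
      (auto intro!: derivative_eq_intros simp: Ck_const)
qed (auto intro!: continuous_intros)

lemma Ck_inner_self: "Ck k (\<lambda>x::'a::real_inner. x \<bullet> x)"
proof (cases k)
  case (Suc j)
  show ?thesis unfolding Suc
  proof (rule Ck_SucI[where u' = "\<lambda>x h. x \<bullet> h + h \<bullet> x"])
    show "((\<lambda>x::'a. x \<bullet> x) has_derivative (\<lambda>h. x \<bullet> h + h \<bullet> x)) (at x)" for x
      by (rule has_derivative_inner[OF has_derivative_ident has_derivative_ident])
    show "Ck j (\<lambda>x::'a. x \<bullet> v + v \<bullet> x)" for v
      using Ck_add[OF Ck_inner_left[of j v] Ck_inner_left[of j v]] by (simp add: inner_commute)
  qed
qed (auto intro!: continuous_intros)

lemma Ck_dist_square: "Ck k (\<lambda>x::'a::real_inner. (x - c) \<bullet> (x - c))"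
proof -
  have "Ck k (\<lambda>x. x \<bullet> x + ((-2) * (x \<bullet> c) + c \<bullet> c))"
    by (intro Ck_add Ck_mult Ck_const Ck_inner_left Ck_inner_self)
  then show ?thesis
    by (simp add: inner_diff_left inner_diff_right inner_commute algebra_simps)
qed

section \<open>A smooth bump function\<close>

text \<open>The functions \<open>p(1/t) exp(-1/t)\<close> on \<open>t > 0\<close>, extended by zero, where \<open>p\<close> is a polynomial. They
  are closed under differentiation, hence all of them are smooth.\<close>

definition flat_exp :: "real poly \<Rightarrow> real \<Rightarrow> real"
  where "flat_exp p t = (if t > 0 then poly p (1 / t) * exp (- (1 / t)) else 0)"

lemma poly_exp_tendsto_0: "((\<lambda>x. poly p x * exp (- x)) \<longlongrightarrow> 0) at_top" for p :: "real poly"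
proof -
  have "((\<lambda>x. \<Sum>i\<le>degree p. coeff p i * (x ^ i / exp x)) \<longlongrightarrow> (\<Sum>i\<le>degree p. coeff p i * 0)) at_top"
    by (intro tendsto_sum tendsto_mult tendsto_const tendsto_power_div_exp_0)
  then show ?thesis
    by (simp add: poly_altdef exp_minus sum_distrib_right sum_divide_distrib field_simps)
qed

lemma flat_exp_DERIV:
  "(flat_exp p has_real_derivative flat_exp ([:0, 0, 1:] * (p - pderiv p)) t) (at t)"
proof -
  consider "t > 0" | "t < 0" | "t = 0" by linarith
  then show ?thesis
  proof cases
    case 1
    have "((\<lambda>t. poly p (1 / t) * exp (- (1 / t))) has_real_derivative
            flat_exp ([:0, 0, 1:] * (p - pderiv p)) t) (at t)"
      using 1 unfolding flat_exp_def
      by (auto intro!: derivative_eq_intros poly_DERIV[THEN DERIV_chain2]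
          simp: field_simps power2_eq_square)
    moreover have "\<forall>\<^sub>F s in nhds t. poly p (1 / s) * exp (- (1 / s)) = flat_exp p s"
      using eventually_nhds_in_open[of "{0<..}" t] 1
      by (auto elim!: eventually_mono simp: flat_exp_def)
    ultimately show ?thesis by (rule iffD1[OF DERIV_cong_ev[OF refl _ refl], rotated])
  next
    case 2
    have "((\<lambda>t. 0) has_real_derivative flat_exp ([:0, 0, 1:] * (p - pderiv p)) t) (at t)"
      using 2 by (simp add: flat_exp_def)
    moreover have "\<forall>\<^sub>F s in nhds t. 0 = flat_exp p s"
      using eventually_nhds_in_open[of "{..<0}" t] 2
      by (auto elim!: eventually_mono simp: flat_exp_def)
    ultimately show ?thesis by (rule iffD1[OF DERIV_cong_ev[OF refl _ refl], rotated])
  next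
    case 3
    have "((\<lambda>x. poly (pCons 0 p) x * exp (- x)) \<longlongrightarrow> 0) at_top" by (rule poly_exp_tendsto_0)
    then have "((\<lambda>h. poly (pCons 0 p) (inverse h) * exp (- inverse h)) \<longlongrightarrow> 0) (at_right 0)"
      by (rule filterlim_compose) (rule filterlim_inverse_at_top_right)
    then have r: "((\<lambda>h. flat_exp p h / h) \<longlongrightarrow> 0) (at_right 0)"
      by (rule Lim_transform_eventually)
        (auto simp: flat_exp_def field_simps eventually_at_right_less
          intro!: eventually_mono[OF eventually_at_right_less[of 0]])
    have l: "((\<lambda>h. flat_exp p h / h) \<longlongrightarrow> 0) (at_left 0)"
      by (rule Lim_transform_eventually[OF tendsto_const])
        (auto simp: flat_exp_def eventually_at_left_field intro!: exI[of _ "-1"])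
    have "((\<lambda>h. flat_exp p h / h) \<longlongrightarrow> 0) (at 0)"
      using l r filterlim_split_at by blast
    then show ?thesis
      unfolding 3 DERIV_def by (simp add: flat_exp_def)
  qed
qed

lemma smooth_flat_exp: "smooth (flat_exp p)"
  unfolding smooth_def
  by (rule exI[of _ "\<lambda>k. flat_exp (((\<lambda>p. [:0, 0, 1:] * (p - pderiv p)) ^^ k) p)"])
    (use flat_exp_DERIV in auto)

text \<open>A smooth function that is positive exactly on the open interval from 0 to 1.\<close>

definition bump :: "real \<Rightarrow> real"
  where "bump t = flat_exp 1 (t * (1 - t))"

lemma bump_eq: "bump t = (if 0 < t \<and> t < 1 then exp (- (1 / (t * (1 - t)))) else 0)"
  by (auto simp: bump_def flat_exp_def zero_less_mult_iff)

lemma bump_nonneg: "0 \<le> bump t" and bump_le_1: "bump t \<le> 1"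
  by (auto simp: bump_eq)

lemma Ck_bump: "Ck k u \<Longrightarrow> Ck k (\<lambda>x. bump (u x))"
  using Ck_compose_smooth[OF smooth_flat_exp[of 1]
      Ck_compose_smooth[OF smooth_poly[of "[:0, 1, -1:]"], of k u]]
  by (simp add: bump_def algebra_simps)

lemma bump_lower: 
  assumes "1/4 \<le> t" "t \<le> 3/4"
  shows "exp (-8) \<le> bump t"
proof -
  have "(t - 1/4) * (3/4 - t) \<ge> 0" using assms by (intro mult_nonneg_nonneg) auto
  moreover have "(t - 1/4) * (3/4 - t) = t * (1 - t) - 3/16" by (simp add: field_simps)
  ultimately have "1/8 \<le> t * (1 - t)" by linarith
  then have "1 / (t * (1 - t)) \<le> 1 / (1/8)" by (intro divide_left_mono) auto
  then show ?thesis using assms by (simp add: bump_eq)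
qed

text \<open>The derivative of \<open>bump\<close> is bounded, and it vanishes wherever \<open>bump\<close> does, because it
  contains the factor \<open>flat_exp p (t * (1 - t))\<close>.\<close>

lemma bump_derivative:
  obtains b' K where "\<And>t. (bump has_real_derivative b' t) (at t)" "\<And>t. \<bar>b' t\<bar> \<le> K" "1 \<le> K"
    "\<And>t. t \<le> 0 \<or> 1 \<le> t \<Longrightarrow> b' t = 0"
proof -
  define p :: "real poly" where "p = [:0, 0, 1:] * (1 - pderiv 1)"
  define b' where "b' t = flat_exp p (t * (1 - t)) * (1 - 2 * t)" for t
  have d: "(bump has_real_derivative b' t) (at t)" for t
  proof -
    have "((\<lambda>t. flat_exp 1 (t * (1 - t))) has_real_derivative
        flat_exp p (t * (1 - t)) * (1 - 2 * t)) (at t)"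
      by (rule DERIV_chain2[OF flat_exp_DERIV[of 1, folded p_def]])
        (auto intro!: derivative_eq_intros)
    then show ?thesis unfolding bump_def[abs_def] b'_def .
  qed
  have z: "b' t = 0" if "t \<le> 0 \<or> 1 \<le> t" for t
    using that by (auto simp: b'_def flat_exp_def zero_less_mult_iff)
  have "continuous_on {0..1} (\<lambda>t. flat_exp p (t * (1 - t)))"
    by (rule continuous_on_compose2[OF smooth_imp_continuous_on[OF smooth_flat_exp, of UNIV]])
      (auto intro!: continuous_intros)
  then have "continuous_on {0..1} b'"
    unfolding b'_def by (intro continuous_intros)
  then have "bounded (b' ` {0..1})"
    using compact_continuous_image compact_imp_bounded by blast
  then obtain B where B: "\<forall>t\<in>{0..1}. \<bar>b' t\<bar> \<le> B"
    unfolding bounded_iff by auto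
  have "\<bar>b' t\<bar> \<le> max 1 B" for t
    using z[of t] B by (cases "t \<le> 0 \<or> 1 \<le> t") (auto simp: le_max_iff_disj)
  then show thesis using that[of b' "max 1 B"] d z by auto
qed

section \<open>Polar coordinates on thin cones\<close>

text \<open>The circular cone around the ray through the unit vector \<open>e\<close>, with opening \<open>c\<close>: the points whose
  direction \<open>x / norm x\<close> has distance at most \<open>c\<close> from \<open>e\<close>, together with the origin.\<close>

definition cone_at :: "'a::euclidean_space \<Rightarrow> real \<Rightarrow> 'a set"
  where "cone_at e c = {x. norm (x - norm x *\<^sub>R e) \<le> c * norm x}"

text \<open>The volume of the part of the cone in the unit ball.\<close>

definition cone_vol :: "'a::euclidean_space \<Rightarrow> real \<Rightarrow> real"
  where "cone_vol e c = measure lborel (cone_at e c \<inter> cball 0 1)"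

lemma cone_vol_nonneg: "0 \<le> cone_vol e c"
  by (simp add: cone_vol_def)

lemma closed_cone_at: "closed (cone_at e c)"
  unfolding cone_at_def by (intro closed_Collect_le continuous_intros)

lemma cone_at_sets [measurable]: "cone_at e c \<in> sets borel"
  by (simp add: closed_cone_at borel_closed)

lemma scaleR_mem_cone_at: "t > 0 \<Longrightarrow> t *\<^sub>R x \<in> cone_at e c \<longleftrightarrow> x \<in> cone_at e c"
proof -
  assume t: "t > 0"
  have "norm (t *\<^sub>R x - norm (t *\<^sub>R x) *\<^sub>R e) = t * norm (x - norm x *\<^sub>R e)"
    using t by (simp add: scaleR_diff_right[symmetric] flip: scaleR_scaleR)
  then show ?thesis using t by (simp add: cone_at_def)
qed

lemma emeasure_cone_cball:
  fixes e :: "'a::euclidean_space"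
  assumes "t > 0"
  shows "emeasure lborel (cone_at e c \<inter> cball 0 t) = ennreal (cone_vol e c * t ^ DIM('a))"
proof -
  let ?S = "cone_at e c \<inter> cball 0 1"
  have "cone_at e c \<inter> cball 0 t = (\<lambda>x. t *\<^sub>R x + 0) ` ?S"
  proof (intro equalityI subsetI)
    fix x assume x: "x \<in> cone_at e c \<inter> cball 0 t"
    have "inverse t *\<^sub>R x \<in> ?S"
      using x assms by (auto simp: scaleR_mem_cone_at field_simps)
    moreover have "x = t *\<^sub>R (inverse t *\<^sub>R x) + 0" using assms by simp
    ultimately show "x \<in> (\<lambda>x. t *\<^sub>R x + 0) ` ?S" by blast
  qed (use assms in \<open>auto simp: scaleR_mem_cone_at mult_left_le\<close>)
  then have "emeasure lebesgue (cone_at e c \<inter> cball 0 t) = \<bar>t\<bar> ^ DIM('a) * emeasure lebesgue ?S"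
    using emeasure_lebesgue_affine[of t 0 ?S] by simp
  moreover have "emeasure lborel ?S = ennreal (cone_vol e c)"
    unfolding cone_vol_def
    by (rule emeasure_eq_ennreal_measure)
      (metis Int_lower2 emeasure_mono emeasure_lborel_cball_finite infinity_ennreal_def
        leD sets_lborel borel_closed closed_cball top_greatest order_le_less_trans less_irrefl)
  ultimately show ?thesis
    using assms by (simp add: emeasure_completion ennreal_mult ennreal_power mult.commute cone_vol_nonneg)
qed

lemma fmeasurable_cball: "cball c r \<in> fmeasurable lborel" for c :: "'a::euclidean_space"
  using emeasure_lborel_cball_finite[of c r] by (auto simp: fmeasurable_def)

text \<open>Polar coordinates on a cone: the image of Lebesgue measure under the norm has density
  proportional to \<open>r ^ (N - 1)\<close>. Both measures have the same mass on every half-line, by the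
  homogeneity of the cone.\<close>

lemma distr_norm_cone:
  fixes e :: "'a::euclidean_space"
  assumes R: "R > 0"
  shows "distr (density lborel (\<lambda>x. ennreal (indicator (cone_at e c \<inter> cball 0 R) x))) borel norm
    = density lborel (\<lambda>r. ennreal (indicator {0..R} r * (DIM('a) * cone_vol e c * r ^ (DIM('a) - 1))))"
    (is "?M = ?N")
proof -
  let ?\<kappa> = "cone_vol e c" let ?d = "DIM('a)"
  have d0: "?d > 0" by simp
  have [measurable]: "norm -` {t<..} \<in> sets (borel :: 'a measure)" for t :: real
    by (intro borel_open open_vimage) (auto intro!: continuous_intros)
  have M: "emeasure ?M {t<..} = ennreal (?\<kappa> * R ^ ?d - ?\<kappa> * (max t 0) ^ ?d)" if "t < R" for t
  proof -
    have ne: "emeasure lborel (cone_at e c \<inter> cball 0 (max t 0)) = ennreal (?\<kappa> * (max t 0) ^ ?d)"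
    proof (cases "t > 0")
      case True then show ?thesis using emeasure_cone_cball[of t e c] by simp
    next
      case False
      have "emeasure lborel (cone_at e c \<inter> {0}) \<le> emeasure lborel {0::'a}"
        by (rule emeasure_mono) auto
      then show ?thesis using False by (simp add: max_def cball_trivial power_0_left)
    qed
    have "emeasure ?M {t<..} =
        emeasure (density lborel (\<lambda>x. ennreal (indicator (cone_at e c \<inter> cball 0 R) x))) (norm -` {t<..})"
      by (subst emeasure_distr) auto
    also have "\<dots> = (\<integral>\<^sup>+x. ennreal (indicator (cone_at e c \<inter> cball 0 R) x) * indicator (norm -` {t<..}) x \<partial>lborel)"
      by (rule emeasure_density) (auto intro!: borel_measurable_indicator)
    also have "\<dots> = (\<integral>\<^sup>+x. indicator (cone_at e c \<inter> cball 0 R \<inter> norm -` {t<..}) x \<partial>lborel)"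
      by (intro nn_integral_cong) (auto simp: indicator_def)
    also have "\<dots> = emeasure lborel (cone_at e c \<inter> cball 0 R \<inter> norm -` {t<..})"
      by (rule nn_integral_indicator) auto
    also have "\<dots> = emeasure lborel (cone_at e c \<inter> cball 0 R \<inter> norm -` {max t 0<..})"
    proof (cases "t \<ge> 0")
      case False
      have "emeasure lborel (cone_at e c \<inter> cball 0 R \<inter> norm -` {t<..})
          = emeasure lborel (cone_at e c \<inter> cball 0 R \<inter> norm -` {max t 0<..})"
        by (rule emeasure_eq_AE)
          (use AE_lborel_singleton[of "0::'a"] False in \<open>auto elim!: eventually_mono
            simp: not_le max_def split: if_splits intro: less_le_trans[OF _ norm_ge_zero]\<close>)
      then show ?thesis .
    qed (simp add: max_def)
    also have "cone_at e c \<inter> cball 0 R \<inter> norm -` {max t 0<..}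
        = (cone_at e c \<inter> cball 0 R) - (cone_at e c \<inter> cball 0 (max t 0))"
      by (auto simp: max_def split: if_splits)
    also have "emeasure lborel \<dots> = emeasure lborel (cone_at e c \<inter> cball 0 R)
        - emeasure lborel (cone_at e c \<inter> cball 0 (max t 0))"
      by (rule emeasure_Diff) (use that R ne in auto)
    also have "\<dots> = ennreal (?\<kappa> * R ^ ?d - ?\<kappa> * (max t 0) ^ ?d)"
      unfolding ne emeasure_cone_cball[OF R]
      by (rule ennreal_minus) (simp add: cone_vol_nonneg)
    finally show ?thesis .
  qed
  have M0: "emeasure ?M {t<..} = 0" if "\<not> t < R" for t
  proof -
    have "emeasure ?M {t<..} =
        (\<integral>\<^sup>+x. ennreal (indicator (cone_at e c \<inter> cball 0 R) x) * indicator (norm -` {t<..}) x \<partial>lborel)"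
      by (subst emeasure_distr, auto, rule emeasure_density)
        (auto intro!: borel_measurable_indicator)
    also have "\<dots> = (\<integral>\<^sup>+x. 0 \<partial>(lborel::'a measure))"
      by (intro nn_integral_cong) (use that in \<open>auto simp: indicator_def\<close>)
    finally show ?thesis by simp
  qed
  have N: "emeasure ?N {t<..} = ennreal (?\<kappa> * R ^ ?d - ?\<kappa> * (max t 0) ^ ?d)" if "t < R" for t
  proof -
    have "emeasure ?N {t<..} = (\<integral>\<^sup>+r. ennreal (indicator {0..R} r * (?d * ?\<kappa> * r ^ (?d - 1))) * indicator {t<..} r \<partial>lborel)"
      by (rule emeasure_density) auto
    also have "\<dots> = (\<integral>\<^sup>+r. ennreal (?d * ?\<kappa> * r ^ (?d - 1)) * indicator {max t 0..R} r \<partial>lborel)"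
      by (rule nn_integral_cong_AE)
        (use AE_lborel_singleton[of t] in \<open>auto elim!: eventually_mono simp: indicator_def\<close>)
    also have "\<dots> = ennreal (?\<kappa> * R ^ ?d - ?\<kappa> * (max t 0) ^ ?d)"
    proof (rule nn_integral_FTC_Icc)
      show "((\<lambda>r. ?\<kappa> * r ^ ?d) has_real_derivative ?d * ?\<kappa> * x ^ (?d - 1)) (at x)" for x
        by (auto intro!: derivative_eq_intros)
    qed (use that R in \<open>auto simp: cone_vol_nonneg\<close>)
    finally show ?thesis .
  qed
  have N0: "emeasure ?N {t<..} = 0" if "\<not> t < R" for t
  proof -
    have "emeasure ?N {t<..} = (\<integral>\<^sup>+r. ennreal (indicator {0..R} r * (?d * ?\<kappa> * r ^ (?d - 1))) * indicator {t<..} r \<partial>lborel)"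
      by (rule emeasure_density) auto
    also have "\<dots> = (\<integral>\<^sup>+r. 0 \<partial>(lborel::real measure))"
      by (rule nn_integral_cong) (use that in \<open>auto simp: indicator_def\<close>)
    finally show ?thesis by simp
  qed
  show ?thesis
  proof (rule measure_eqI_lessThan)
    show "emeasure ?M {t<..} < \<infinity>" for t using M[of t] M0[of t] by (cases "t < R") auto
    show "emeasure ?M {t<..} = emeasure ?N {t<..}" for t
      using M[of t] M0[of t] N[of t] N0[of t] by (cases "t < R") auto
  qed auto
qed

text \<open>The integral of a radial function over a part of the cone, with the weight that cancels the
  density of the image measure; the radial integrand enters through a primitive.\<close>

lemma cone_annulus_integral:
  fixes e :: "'a::euclidean_space" and F g :: "real \<Rightarrow> real" and c :: real
  assumes ab: "0 < a" "a \<le> b" and g: "continuous_on {a..b} g"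
    and F: "\<forall>r\<in>{a..b}. (F has_real_derivative g r) (at r)"
  defines "G \<equiv> \<lambda>x. indicator (cone_at e c \<inter> {x. a \<le> norm x \<and> norm x \<le> b}) x
      * (g (norm x) * norm x powr (1 - real DIM('a)))"
  shows "integrable lborel G" and "integral\<^sup>L lborel G = DIM('a) * cone_vol e c * (F b - F a)"
proof -
  let ?\<kappa> = "cone_vol e c" let ?d = "DIM('a)"
  have b: "b > 0" using ab by simp
  define h where "h r = indicator {a..b} r * (g r * r powr (1 - real ?d))" for r
  have "continuous_on {a..b} (\<lambda>r. g r * r powr (1 - real ?d))"
    using ab g by (intro continuous_intros) auto
  from borel_measurable_continuous_on_indicator[OF _ this]
  have h[measurable]: "h \<in> borel_measurable borel"
    by (simp add: h_def[abs_def])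
  let ?M = "density lborel (\<lambda>x. ennreal (indicator (cone_at e c \<inter> cball 0 b) x))"
  let ?D = "\<lambda>r. indicator {0..b} r * (?d * ?\<kappa> * r ^ (?d - 1))"
  let ?N = "density lborel (\<lambda>r. ennreal (?D r))"
  have eq: "distr ?M borel norm = ?N" by (rule distr_norm_cone[OF b])
  have Dh: "?D r *\<^sub>R h r = ?d * ?\<kappa> * (indicator {a..b} r *\<^sub>R g r)" for r
  proof (cases "r \<in> {a..b}")
    case True
    have "r ^ (?d - 1) * r powr (1 - real ?d) = 1"
    proof -
      have "r ^ (?d - 1) = r powr (real ?d - 1)"
        using True ab by (simp add: powr_realpow[symmetric] of_nat_diff)
      then show ?thesis using True ab by (simp add: powr_add[symmetric])
    qed
    then show ?thesis using True ab by (simp add: h_def)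
  qed (simp add: h_def)
  have GG: "indicator (cone_at e c \<inter> cball 0 b) x *\<^sub>R h (norm x) = G x" for x
    by (auto simp: G_def h_def indicator_def)
  have int: "integrable lborel (\<lambda>r. indicator {a..b} r *\<^sub>R g r)"
    by (rule borel_integrable_compact[OF _ g]) auto
  have D0: "AE r in lborel. 0 \<le> ?D r" by (simp add: cone_vol_nonneg indicator_def)
  have Dm: "?D \<in> borel_measurable lborel" by simp
  have "integrable lborel (\<lambda>r. ?D r *\<^sub>R h r)"
    unfolding Dh by (intro integrable_mult_right int)
  then have "integrable ?N h"
    by (intro iffD2[OF integrable_density] D0 Dm) auto
  then have "integrable ?M (\<lambda>x. h (norm x))"
    unfolding eq[symmetric] by (subst (asm) integrable_distr_eq) auto
  then show "integrable lborel G"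
    by (subst (asm) integrable_density)
      (auto simp: GG[unfolded real_scaleR_def] intro!: borel_measurable_indicator)
  have "integral\<^sup>L lborel G = integral\<^sup>L ?M (\<lambda>x. h (norm x))"
    by (subst integral_density)
      (auto simp: GG[unfolded real_scaleR_def] intro!: borel_measurable_indicator)
  also have "\<dots> = integral\<^sup>L ?N h"
    unfolding eq[symmetric] by (subst integral_distr) auto
  also have "\<dots> = integral\<^sup>L lborel (\<lambda>r. ?d * ?\<kappa> * (indicator {a..b} r *\<^sub>R g r))"
    unfolding Dh[symmetric] by (rule integral_density) (use D0 Dm in auto)
  also have "\<dots> = ?d * ?\<kappa> * integral\<^sup>L lborel (\<lambda>r. indicator {a..b} r *\<^sub>R g r)"
    by (rule integral_mult_right_zero)
  also have "integral\<^sup>L lborel (\<lambda>r. indicator {a..b} r *\<^sub>R g r) = F b - F a"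
    by (rule integral_FTC_atLeastAtMost[OF ab(2) _ g])
      (use F in \<open>auto simp: has_real_derivative_iff_has_vector_derivative[symmetric]
        intro: has_field_derivative_at_within\<close>)
  finally show "integral\<^sup>L lborel G = ?d * ?\<kappa> * (F b - F a)" .
qed

lemma measure_cone_shell:
  fixes e :: "'a::euclidean_space"
  assumes "0 < s" "s \<le> t"
  shows "measure lborel (cone_at e c \<inter> cball 0 t - cball 0 s) = cone_vol e c * (t ^ DIM('a) - s ^ DIM('a))"
proof -
  have "cone_at e c \<inter> cball 0 t - cball 0 s = cone_at e c \<inter> cball 0 t - (cone_at e c \<inter> cball 0 s)"
    by auto
  moreover have "measure lborel (cone_at e c \<inter> cball 0 t - (cone_at e c \<inter> cball 0 s))
      = measure lborel (cone_at e c \<inter> cball 0 t) - measure lborel (cone_at e c \<inter> cball 0 s)"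
    by (rule measure_Diff) (use assms emeasure_cone_cball[of _ e c] in auto)
  moreover have "measure lborel (cone_at e c \<inter> cball 0 r) = cone_vol e c * r ^ DIM('a)" if "r > 0" for r
    using emeasure_cone_cball[OF that, of e c] that by (simp add: measure_def cone_vol_nonneg)
  ultimately show ?thesis using assms by (simp add: algebra_simps)
qed

text \<open>Near the point \<open>r e\<close>, the distance to that point and the distance to the point of the same norm
  on the axis differ by at most \<open>\<bar>norm x - r\<bar>\<close>; this relates cones and balls.\<close>

lemma norm_diff_axis_le:
  assumes "norm e = 1" "0 \<le> r"
  shows "norm (x - norm x *\<^sub>R e) \<le> norm (x - r *\<^sub>R e) + \<bar>norm x - r\<bar>"
    and "norm (x - norm x *\<^sub>R e) \<le> 2 * norm (x - r *\<^sub>R e)"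
    and "norm (x - r *\<^sub>R e) \<le> norm (x - norm x *\<^sub>R e) + \<bar>norm x - r\<bar>"
proof -
  have n: "norm ((norm x - r) *\<^sub>R e) = \<bar>norm x - r\<bar>" using assms by simp
  have *: "x - norm x *\<^sub>R e = (x - r *\<^sub>R e) - (norm x - r) *\<^sub>R e"
    by (simp add: algebra_simps)
  show 1: "norm (x - norm x *\<^sub>R e) \<le> norm (x - r *\<^sub>R e) + \<bar>norm x - r\<bar>"
    unfolding * using norm_triangle_ineq4[of "x - r *\<^sub>R e" "(norm x - r) *\<^sub>R e"] unfolding n .
  have "\<bar>norm x - norm (r *\<^sub>R e)\<bar> \<le> norm (x - r *\<^sub>R e)" by (rule norm_triangle_ineq3)
  then show "norm (x - norm x *\<^sub>R e) \<le> 2 * norm (x - r *\<^sub>R e)" using 1 assms by simp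
  have **: "x - r *\<^sub>R e = (x - norm x *\<^sub>R e) + (norm x - r) *\<^sub>R e"
    by (simp add: algebra_simps)
  show "norm (x - r *\<^sub>R e) \<le> norm (x - norm x *\<^sub>R e) + \<bar>norm x - r\<bar>"
    unfolding ** using norm_triangle_ineq[of "x - norm x *\<^sub>R e" "(norm x - r) *\<^sub>R e"] unfolding n .
qed

text \<open>The two bounds say that a cone of opening proportional to \<open>\<epsilon>\<close> has volume comparable to
  \<open>\<epsilon> ^ (N - 1)\<close>: its part in a shell of thickness \<open>\<epsilon>\<close> is compared with balls of radius
  proportional to \<open>\<epsilon>\<close>.\<close>

lemma cone_vol_le:
  fixes e :: "'a::euclidean_space"
  assumes e: "norm e = 1" and \<epsilon>: "0 < \<epsilon>" "\<epsilon> \<le> 1 / 2" and K: "0 \<le> K"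
  shows "cone_vol e (K * \<epsilon>) \<le> unit_ball_vol DIM('a) * (K + 1) ^ DIM('a) * \<epsilon> ^ (DIM('a) - 1)"
proof -
  let ?d = "DIM('a)"
  let ?S = "cone_at e (K * \<epsilon>) \<inter> cball 0 1 - cball 0 (1 - \<epsilon>)"
  have d: "?d = Suc (?d - 1)" by simp
  have "?S \<subseteq> cball e ((K + 1) * \<epsilon>)"
  proof
    fix x assume x: "x \<in> ?S"
    have "K * \<epsilon> * norm x \<le> K * \<epsilon>" using x K \<epsilon> by (intro mult_left_le) auto
    moreover have "norm (x - e) \<le> norm (x - norm x *\<^sub>R e) + \<bar>norm x - 1\<bar>"
      using norm_diff_axis_le(3)[OF e, of 1 x] by simp
    ultimately have "norm (x - e) \<le> (K + 1) * \<epsilon>"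
      using x by (auto simp: cone_at_def algebra_simps)
    then show "x \<in> cball e ((K + 1) * \<epsilon>)" by (simp add: dist_norm norm_minus_commute)
  qed
  then have "measure lborel ?S \<le> measure lborel (cball e ((K + 1) * \<epsilon>))"
    by (rule measure_mono_fmeasurable) (auto simp: fmeasurable_cball)
  also have "\<dots> = unit_ball_vol ?d * ((K + 1) * \<epsilon>) ^ ?d"
    using content_cball[of "(K + 1) * \<epsilon>" e] K \<epsilon> by simp
  finally have "cone_vol e (K * \<epsilon>) * (1 - (1 - \<epsilon>) ^ ?d) \<le> unit_ball_vol ?d * ((K + 1) * \<epsilon>) ^ ?d"
    using measure_cone_shell[of "1 - \<epsilon>" 1 e "K * \<epsilon>"] \<epsilon> by simp
  moreover have "(1 - \<epsilon>) ^ ?d \<le> 1 - \<epsilon>"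
    using power_decreasing[of 1 ?d "1 - \<epsilon>"] \<epsilon> d by simp
  then have "cone_vol e (K * \<epsilon>) * \<epsilon> \<le> cone_vol e (K * \<epsilon>) * (1 - (1 - \<epsilon>) ^ ?d)"
    by (intro mult_left_mono) (auto simp: cone_vol_nonneg)
  ultimately have "cone_vol e (K * \<epsilon>) * \<epsilon> \<le> unit_ball_vol ?d * ((K + 1) * \<epsilon>) ^ ?d" by linarith
  also have "\<dots> = (unit_ball_vol ?d * (K + 1) ^ ?d * \<epsilon> ^ (?d - 1)) * \<epsilon>"
  proof -
    have "\<epsilon> ^ ?d = \<epsilon> ^ (?d - 1) * \<epsilon>" by (metis d power_Suc2)
    then show ?thesis by (simp add: power_mult_distrib)
  qed
  finally show ?thesis using \<epsilon> by simp
qed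

lemma cone_vol_ge:
  fixes e :: "'a::euclidean_space"
  assumes e: "norm e = 1" and \<epsilon>: "0 < \<epsilon>" "\<epsilon> \<le> 1 / 2"
  shows "unit_ball_vol DIM('a) / (8 ^ DIM('a) * DIM('a)) * \<epsilon> ^ (DIM('a) - 1) \<le> cone_vol e \<epsilon>"
proof -
  let ?d = "DIM('a)"
  let ?S = "cone_at e \<epsilon> \<inter> cball 0 1 - cball 0 (1 - \<epsilon>)"
  have d: "?d = Suc (?d - 1)" by simp
  have "cball ((1 - \<epsilon> / 2) *\<^sub>R e) (\<epsilon> / 8) \<subseteq> ?S"
  proof
    fix x assume "x \<in> cball ((1 - \<epsilon> / 2) *\<^sub>R e) (\<epsilon> / 8)"
    then have x: "norm (x - (1 - \<epsilon> / 2) *\<^sub>R e) \<le> \<epsilon> / 8" by (simp add: dist_norm norm_minus_commute)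
    have "\<bar>norm x - norm ((1 - \<epsilon> / 2) *\<^sub>R e)\<bar> \<le> \<epsilon> / 8" using norm_triangle_ineq3 x order_trans by blast
    then have nx: "\<bar>norm x - (1 - \<epsilon> / 2)\<bar> \<le> \<epsilon> / 8" using e \<epsilon> by simp
    have "norm (x - norm x *\<^sub>R e) \<le> \<epsilon> * (1 / 4)"
      using norm_diff_axis_le(2)[OF e, of "1 - \<epsilon> / 2" x] x \<epsilon> by simp
    also have "\<dots> \<le> \<epsilon> * norm x" using nx \<epsilon> by (intro mult_left_mono) (auto simp: abs_if split: if_splits)
    finally show "x \<in> ?S" using nx \<epsilon> by (auto simp: cone_at_def abs_if split: if_splits)
  qed
  moreover have "?S \<in> fmeasurable lborel"
  proof (rule fmeasurableI2)
    show "cball 0 1 \<in> fmeasurable lborel" by (rule fmeasurable_cball)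
  qed auto
  ultimately have "measure lborel (cball ((1 - \<epsilon> / 2) *\<^sub>R e) (\<epsilon> / 8)) \<le> measure lborel ?S"
    by (intro measure_mono_fmeasurable) auto
  then have "unit_ball_vol ?d * (\<epsilon> / 8) ^ ?d \<le> cone_vol e \<epsilon> * (1 - (1 - \<epsilon>) ^ ?d)"
    using measure_cone_shell[of "1 - \<epsilon>" 1 e \<epsilon>] \<epsilon>
      content_cball[of "\<epsilon> / 8" "(1 - \<epsilon> / 2) *\<^sub>R e"] by simp
  also have "\<dots> \<le> cone_vol e \<epsilon> * (?d * \<epsilon>)"
    using Bernoulli_inequality[of "- \<epsilon>" ?d] \<epsilon>
    by (intro mult_left_mono) (auto simp: cone_vol_nonneg)
  finally have *: "unit_ball_vol ?d * (\<epsilon> / 8) ^ ?d \<le> cone_vol e \<epsilon> * (?d * \<epsilon>)" .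
  have "unit_ball_vol ?d * (\<epsilon> / 8) ^ ?d
      = unit_ball_vol ?d / (8 ^ ?d * ?d) * \<epsilon> ^ (?d - 1) * (?d * \<epsilon>)"
  proof -
    have "\<epsilon> ^ ?d = \<epsilon> ^ (?d - 1) * \<epsilon>" by (metis d power_Suc2)
    then show ?thesis by (simp add: power_divide)
  qed
  then have "unit_ball_vol ?d / (8 ^ ?d * ?d) * \<epsilon> ^ (?d - 1) * (?d * \<epsilon>)
      \<le> cone_vol e \<epsilon> * (?d * \<epsilon>)" using * by simp
  then show ?thesis by (rule mult_right_le_imp_le) (use \<epsilon> in simp)
qed

section \<open>Weights and the function \<open>f_eta\<close>\<close>

lemma weights_pos: "w \<in> weights \<Longrightarrow> 0 < t \<Longrightarrow> 0 < w t"
  by (simp add: weights_def)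

lemma weights_isCont: "w \<in> weights \<Longrightarrow> 0 < t \<Longrightarrow> isCont w t"
  unfolding weights_def C1_differentiable_on_eq
  by (auto intro: differentiable_imp_continuous_within)

lemma weights_isCont_inverse: "w \<in> weights \<Longrightarrow> 0 < t \<Longrightarrow> isCont (\<lambda>s. 1 / w s) t"
  using weights_pos[of w t] weights_isCont[of w t] by (auto intro!: continuous_intros)

lemma weights_continuous_on_inverse:
  "w \<in> weights \<Longrightarrow> S \<subseteq> {0<..} \<Longrightarrow> continuous_on S (\<lambda>s. 1 / w s)"
  by (intro continuous_at_imp_continuous_on ballI weights_isCont_inverse) auto

lemma weights_Q_iff: "w \<in> weights \<Longrightarrow> w \<in> weights_Q \<longleftrightarrow> w \<notin> weights_P"
  by (auto simp: weights_Q_def weights_P_def)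

lemma weights_Q_integrable:
  assumes "w \<in> weights_Q"
  shows "set_integrable lborel {0..t} (\<lambda>s. 1 / w s)"
proof -
  have "set_integrable lborel {0<..<max 1 t} (\<lambda>s. 1 / w s)"
    using assms by (auto simp: weights_Q_def)
  then have "set_integrable lborel {0..max 1 t} (\<lambda>s. 1 / w s)"
    by (rule iffD1[OF set_integrable_discrete_difference[where X = "{0, max 1 t}"], rotated -1])
      (auto simp: max_def)
  then show ?thesis by (rule set_integrable_subset) auto
qed

lemma f_eta_Q_eq_integral:
  assumes "w \<in> weights_Q" "0 \<le> t"
  shows "f_eta \<mu> \<eta> w t = integral {0..t} (\<lambda>s. 1 / w s)"
proof -
  have "w \<notin> weights_P" using assms weights_Q_iff by (auto simp: weights_Q_def)
  then show ?thesis
    using interval_integral_eq_integral[OF assms(2) weights_Q_integrable[OF assms(1)]]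
    by (simp add: f_eta_def zero_ereal_def)
qed

lemma f_eta_Q_DERIV:
  assumes "w \<in> weights_Q" "0 < t"
  shows "(f_eta \<mu> \<eta> w has_real_derivative 1 / w t) (at t)"
proof -
  have w: "w \<in> weights" using assms by (simp add: weights_Q_def)
  have "((\<lambda>u. integral {0..u} (\<lambda>s. 1 / w s)) has_vector_derivative 1 / w t) (at t within {0..t + 1} - {})"
    by (rule integral_has_vector_derivative_continuous_at)
      (use assms w weights_isCont_inverse in \<open>auto intro: continuous_at_imp_continuous_at_within
        set_borel_integral_eq_integral(1)[OF weights_Q_integrable]\<close>)
  then have "((\<lambda>u. integral {0..u} (\<lambda>s. 1 / w s)) has_real_derivative 1 / w t) (at t)"
    using assms at_within_interior[of t "{0..t + 1}"]
    by (simp add: has_real_derivative_iff_has_vector_derivative)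
  moreover have "\<forall>\<^sub>F u in nhds t. integral {0..u} (\<lambda>s. 1 / w s) = f_eta \<mu> \<eta> w u"
    using eventually_nhds_in_open[of "{0<..}" t] assms
    by (auto elim!: eventually_mono simp: f_eta_Q_eq_integral)
  ultimately show ?thesis by (rule iffD1[OF DERIV_cong_ev[OF refl _ refl], rotated])
qed

lemma f_eta_P_DERIV:
  assumes "w \<in> weights_P" "0 < t" "0 < \<eta>"
  shows "(f_eta \<mu> \<eta> w has_real_derivative - (1 / w t)) (at t)"
proof -
  have w: "w \<in> weights" using assms by (simp add: weights_P_def)
  define l where "l = min t \<eta> / 2"
  define u where "u = max t \<eta> + 1"
  have b: "0 < l" "l < t" "l < \<eta>" "t < u" "\<eta> < u" using assms by (auto simp: l_def u_def)
  have "((\<lambda>v. LBINT s=\<eta>..v. 1 / w s) has_vector_derivative 1 / w t) (at t within {l..u})"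
    by (rule interval_integral_FTC2) (use b w in \<open>auto intro: weights_continuous_on_inverse\<close>)
  then have d: "((\<lambda>v. LBINT s=\<eta>..v. 1 / w s) has_real_derivative 1 / w t) (at t)"
    using b at_within_interior[of t "{l..u}"]
    by (simp add: has_real_derivative_iff_has_vector_derivative)
  have "f_eta \<mu> \<eta> w = (\<lambda>v. \<mu> - (LBINT s=\<eta>..v. 1 / w s))"
    using assms by (auto simp: f_eta_def fun_eq_iff interval_integral_endpoints_reverse[of "ereal \<eta>"])
  moreover have "((\<lambda>v. \<mu> - (LBINT s=\<eta>..v. 1 / w s)) has_real_derivative - (1 / w t)) (at t)"
    using d by (auto intro!: derivative_eq_intros)
  ultimately show ?thesis by simp
qed

lemma f_eta_Q_less:
  assumes "w \<in> weights_Q" "0 < s" "s < t"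
  shows "f_eta \<mu> \<eta> w s < f_eta \<mu> \<eta> w t"
proof (rule DERIV_pos_imp_increasing[OF assms(3)])
  fix x assume "s \<le> x"
  then show "\<exists>y. (f_eta \<mu> \<eta> w has_real_derivative y) (at x) \<and> 0 < y"
    using f_eta_Q_DERIV[OF assms(1), of x \<mu> \<eta>] weights_pos[of w x] assms
    by (intro exI[of _ "1 / w x"]) (simp add: weights_Q_def)
qed

lemma f_eta_P_less:
  assumes "w \<in> weights_P" "0 < \<eta>" "0 < s" "s < t"
  shows "f_eta \<mu> \<eta> w t < f_eta \<mu> \<eta> w s"
proof (rule DERIV_neg_imp_decreasing[OF assms(4)])
  fix x assume "s \<le> x"
  then show "\<exists>y. (f_eta \<mu> \<eta> w has_real_derivative y) (at x) \<and> y < 0"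
    using f_eta_P_DERIV[OF assms(1), of x \<eta> \<mu>] weights_pos[of w x] assms
    by (intro exI[of _ "- (1 / w x)"]) (simp add: weights_P_def)
qed

lemma f_eta_Q_tendsto:
  assumes "w \<in> weights_Q"
  shows "(f_eta \<mu> \<eta> w \<longlongrightarrow> 0) (at_right 0)"
proof -
  have "continuous_on {0..1} (\<lambda>t. integral {0..t} (\<lambda>s. 1 / w s))"
    by (intro indefinite_integral_continuous_1 set_borel_integral_eq_integral(1) weights_Q_integrable assms)
  then have "((\<lambda>t. integral {0..t} (\<lambda>s. 1 / w s)) \<longlongrightarrow> integral {0..0} (\<lambda>s. 1 / w s)) (at 0 within {0..1})"
    unfolding continuous_on_def by (rule bspec) simp
  then have "((\<lambda>t. integral {0..t} (\<lambda>s. 1 / w s)) \<longlongrightarrow> 0) (at_right 0)"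
    using at_within_Icc_at_right[of 0 "1::real"] by simp
  then show ?thesis
    by (rule Lim_transform_eventually)
      (use eventually_at_right_less[of "0::real"] in \<open>auto elim!: eventually_mono
        simp: f_eta_Q_eq_integral[OF assms]\<close>)
qed

lemma f_eta_Q_pos:
  assumes "w \<in> weights_Q" "0 < t"
  shows "0 < f_eta \<mu> \<eta> w t"
proof -
  have "0 \<le> f_eta \<mu> \<eta> w (t / 2)"
  proof (rule tendsto_upperbound[OF f_eta_Q_tendsto[OF assms(1)]])
    show "\<forall>\<^sub>F s in at_right 0. f_eta \<mu> \<eta> w s \<le> f_eta \<mu> \<eta> w (t / 2)"
      using assms by (auto simp: eventually_at_right_field intro!: exI[of _ "t/2"] less_imp_le f_eta_Q_less)
  qed auto
  also have "\<dots> < f_eta \<mu> \<eta> w t" using assms by (intro f_eta_Q_less) auto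
  finally show ?thesis .
qed

lemma f_eta_P_pos:
  assumes "w \<in> weights_P" "0 < t" "t \<le> \<eta>" "0 < \<mu>"
  shows "0 < f_eta \<mu> \<eta> w t"
proof -
  have "f_eta \<mu> \<eta> w \<eta> = \<mu>" using assms by (simp add: f_eta_def)
  then show ?thesis
    using f_eta_P_less[of w \<eta> t \<eta> \<mu>] assms by (cases "t = \<eta>") auto
qed

text \<open>If the decreasing function \<open>f_eta\<close> stayed bounded at the origin, it would have a limit there, and
  \<open>1 / w\<close> would be integrable near the origin.\<close>

lemma f_eta_P_at_top:
  assumes w: "w \<in> weights_P" and \<eta>: "0 < \<eta>"
  shows "filterlim (f_eta \<mu> \<eta> w) at_top (at_right 0)"
proof -
  let ?f = "f_eta \<mu> \<eta> w"
  have mono: "0 < s \<Longrightarrow> s \<le> t \<Longrightarrow> ?f t \<le> ?f s" for s t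
    using f_eta_P_less[OF w \<eta>, of s t \<mu>] by (cases "s = t") auto
  have w': "w \<in> weights" using w by (simp add: weights_P_def)
  have ex: "\<exists>t>0. Z \<le> ?f t" for Z
  proof (rule ccontr)
    assume "\<not> (\<exists>t>0. Z \<le> ?f t)"
    then have bdd: "bdd_above (?f ` {0<..})" by (auto intro!: bdd_aboveI[of _ Z])
    define L where "L = (SUP t\<in>{0<..}. ?f t)"
    have le: "?f t \<le> L" if "t > 0" for t
      unfolding L_def using bdd that by (intro cSUP_upper) auto
    have lim: "(?f \<longlongrightarrow> L) (at_right 0)"
    proof (rule increasing_tendsto)
      show "\<forall>\<^sub>F t in at_right 0. ?f t \<le> L"
        using eventually_at_right_less[of "0::real"] by eventually_elim (rule le)
      fix y assume "y < L"
      then obtain t where t: "0 < t" "y < ?f t"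
        unfolding L_def using less_cSUP_iff[OF _ bdd, of y] by auto
      have "\<forall>\<^sub>F s in at_right 0. s < t" using t(1) by (rule eventually_at_right_real[THEN eventually_mono]) auto
      with eventually_at_right_less[of "0::real"] show "\<forall>\<^sub>F s in at_right 0. y < ?f s"
        by eventually_elim (meson t(2) mono less_imp_le less_le_trans)
    qed
    have "set_integrable lborel {0<..<c} (\<lambda>s. 1 / w s)" if c: "c > 0" for c
    proof -
      have "set_integrable lborel (einterval (ereal 0) (ereal c)) (\<lambda>s. 1 / w s)"
      proof (rule interval_integral_FTC_nonneg(1)[where F = "\<lambda>t. - ?f t"])
        show "DERIV (\<lambda>t. - ?f t) x :> 1 / w x" if "ereal 0 < ereal x" for x
          using DERIV_minus[OF f_eta_P_DERIV[OF w _ \<eta>]] that by simp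
        show "isCont (\<lambda>s. 1 / w s) x" if "ereal 0 < ereal x" for x
          using weights_isCont_inverse[OF w'] that by simp
        show "AE x in lborel. ereal 0 < ereal x \<longrightarrow> ereal x < ereal c \<longrightarrow> 0 \<le> 1 / w x"
          using weights_pos[OF w'] by (auto intro!: AE_I2 less_imp_le)
        show "(((\<lambda>t. - ?f t) \<circ> real_of_ereal) \<longlongrightarrow> - L) (at_right (ereal 0))"
          unfolding ereal_tendsto_simps using lim by (intro tendsto_minus)
        have "isCont (\<lambda>t. - ?f t) c"
          by (intro isCont_minus DERIV_isCont[OF f_eta_P_DERIV[OF w c \<eta>]])
        then show "(((\<lambda>t. - ?f t) \<circ> real_of_ereal) \<longlongrightarrow> - ?f c) (at_left (ereal c))"
          unfolding ereal_tendsto_simps isCont_def by (rule tendsto_within_subset) auto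
      qed (use c in auto)
      then show ?thesis by simp
    qed
    then show False using w by (auto simp: weights_P_def)
  qed
  show ?thesis
    unfolding filterlim_at_top
  proof
    fix Z
    obtain t where t: "0 < t" "Z \<le> ?f t" using ex by blast
    have "\<forall>\<^sub>F s in at_right 0. s < t" using t(1) by (rule eventually_at_right_real[THEN eventually_mono]) auto
    with eventually_at_right_less[of "0::real"] show "\<forall>\<^sub>F s in at_right 0. Z \<le> ?f s"
      by eventually_elim (meson t(2) mono less_imp_le order_trans)
  qed
qed

text \<open>The inverse function of \<open>phi\<close> on \<open>{0<..\<eta>}\<close>.\<close>

definition phi_inv :: "real \<Rightarrow> real \<Rightarrow> (real \<Rightarrow> real) \<Rightarrow> real \<Rightarrow> real"
  where "phi_inv \<mu> \<eta> w t = (if w \<in> weights_P then 1 / f_eta \<mu> \<eta> w t else f_eta \<mu> \<eta> w t)"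

lemma f_eta_pos:
  assumes "w \<in> weights" "0 < t" "t \<le> \<eta>" "0 < \<mu>"
  shows "0 < f_eta \<mu> \<eta> w t"
  using assms f_eta_P_pos f_eta_Q_pos weights_Q_iff by metis

lemma phi_inv_DERIV:
  assumes w: "w \<in> weights" and t: "0 < t" "t \<le> \<eta>" and \<mu>: "0 < \<mu>"
  shows "(phi_inv \<mu> \<eta> w has_real_derivative phi_inv \<mu> \<eta> w t / (w t * f_eta \<mu> \<eta> w t)) (at t)"
proof (cases "w \<in> weights_P")
  case True
  have "((\<lambda>t. 1 / f_eta \<mu> \<eta> w t) has_real_derivative 1 / f_eta \<mu> \<eta> w t / (w t * f_eta \<mu> \<eta> w t)) (at t)"
    using f_eta_P_DERIV[OF True t(1), of \<eta> \<mu>] f_eta_P_pos[OF True t \<mu>] t weights_pos[OF w t(1)]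
    by (auto intro!: derivative_eq_intros simp: field_simps)
  then show ?thesis using True by (simp add: phi_inv_def[abs_def])
next
  case False
  then have Q: "w \<in> weights_Q" using w weights_Q_iff by blast
  show ?thesis using False f_eta_Q_DERIV[OF Q t(1), of \<mu> \<eta>] f_eta_Q_pos[OF Q t(1), of \<mu> \<eta>]
    by (simp add: phi_inv_def[abs_def])
qed

lemma phi_phi_inv:
  assumes w: "w \<in> weights" and t: "0 < t" "t \<le> \<eta>" and \<mu>: "0 < \<mu>"
  shows "phi \<mu> \<eta> w (phi_inv \<mu> \<eta> w t) = t"
proof -
  have inj: "s = t" if "0 < s" "f_eta \<mu> \<eta> w s = f_eta \<mu> \<eta> w t" for s
    using that t f_eta_P_less[of w \<eta> s t \<mu>] f_eta_P_less[of w \<eta> t s \<mu>]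
      f_eta_Q_less[of w s t \<mu> \<eta>] f_eta_Q_less[of w t s \<mu> \<eta>] weights_Q_iff[OF w]
    by (cases "w \<in> weights_P"; cases s t rule: linorder_cases) auto
  show ?thesis
    unfolding phi_def
  proof (rule the_equality)
    show "t \<in> {0<..\<eta>} \<and> (if w \<in> weights_P then 1 / phi_inv \<mu> \<eta> w t = \<mu> + (LBINT s=t..\<eta>. 1 / w s)
        else phi_inv \<mu> \<eta> w t = (LBINT s=0..t. 1 / w s))"
      using t by (auto simp: phi_inv_def f_eta_def)
    fix s assume "s \<in> {0<..\<eta>} \<and> (if w \<in> weights_P then 1 / phi_inv \<mu> \<eta> w t = \<mu> + (LBINT s=s..\<eta>. 1 / w s)
        else phi_inv \<mu> \<eta> w t = (LBINT s=0..s. 1 / w s))"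
    then have "0 < s" "f_eta \<mu> \<eta> w s = f_eta \<mu> \<eta> w t"
      by (auto simp: phi_inv_def f_eta_def split: if_splits)
    then show "s = t" by (rule inj)
  qed
qed

text \<open>In the variable \<open>t = phi \<rho>\<close>, the function \<open>H\<close> is the ratio of the length scale \<open>w f_eta\<close>, on
  which \<open>log f_eta\<close> varies by one, to the radius \<open>t\<close>.\<close>

lemma H_phi_inv:
  assumes w: "w \<in> weights" and t: "0 < t" "t < \<eta>" and \<mu>: "0 < \<mu>"
  shows "H \<mu> \<eta> w (phi_inv \<mu> \<eta> w t) = w t * f_eta \<mu> \<eta> w t / t"
proof -
  let ?g = "phi_inv \<mu> \<eta> w"
  have p: "0 < w t" "0 < f_eta \<mu> \<eta> w t" "0 < ?g t"
    using weights_pos[OF w t(1)] f_eta_pos[OF w t(1) _ \<mu>] t by (auto simp: phi_inv_def)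
  have "(phi \<mu> \<eta> w has_real_derivative inverse (?g t / (w t * f_eta \<mu> \<eta> w t))) (at (?g t))"
    unfolding has_field_derivative_def
  proof (rule has_derivative_inverse_strong[where f = ?g and x = t and S = "{0<..<\<eta>}"])
    show "(?g has_derivative (*) (?g t / (w t * f_eta \<mu> \<eta> w t))) (at t)"
      using phi_inv_DERIV[OF w t(1) _ \<mu>] t by (simp add: has_field_derivative_def)
    show "open {0<..<\<eta>}" by simp
    show "continuous_on {0<..<\<eta>} ?g"
      by (intro continuous_at_imp_continuous_on ballI DERIV_isCont[OF phi_inv_DERIV[OF w _ _ \<mu>]]) auto
  qed (use p t phi_phi_inv[OF w _ _ \<mu>] in \<open>auto simp: fun_eq_iff\<close>)
  then have "deriv (phi \<mu> \<eta> w) (?g t) = w t * f_eta \<mu> \<eta> w t / ?g t"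
    by (simp add: DERIV_imp_deriv field_simps)
  then show ?thesis
    using p phi_phi_inv[OF w t(1) _ \<mu>] t by (simp add: H_def)
qed

lemma phi_inv_tendsto:
  assumes w: "w \<in> weights" and \<mu>: "0 < \<mu>" "0 < \<eta>"
  shows "filterlim (phi_inv \<mu> \<eta> w) (at_right 0) (at_right 0)"
unfolding filterlim_at
proof (intro conjI)
  show "(phi_inv \<mu> \<eta> w \<longlongrightarrow> 0) (at_right 0)"
  proof (cases "w \<in> weights_P")
    case True
    then show ?thesis
      using tendsto_inverse_0_at_top[OF f_eta_P_at_top[OF True \<mu>(2), of \<mu>]]
      by (simp add: phi_inv_def[abs_def] inverse_eq_divide)
  next
    case False
    then show ?thesis
      using f_eta_Q_tendsto[of w \<mu> \<eta>] weights_Q_iff[OF w] by (simp add: phi_inv_def[abs_def])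
  qed
  have "\<forall>\<^sub>F t in at_right 0. t \<in> {0<..<\<eta>}" by (rule eventually_at_right_real[OF \<mu>(2)])
  then show "\<forall>\<^sub>F t in at_right 0. phi_inv \<mu> \<eta> w t \<in> {0<..} \<and> phi_inv \<mu> \<eta> w t \<noteq> 0"
    by eventually_elim (use f_eta_pos[OF w _ _ \<mu>(1)] in \<open>auto simp: phi_inv_def less_imp_le less_le\<close>)
qed

lemma weight_small_if_H_tendsto_0:
  assumes w: "w \<in> weights" and \<mu>: "0 < \<mu>" "0 < \<eta>" and H: "(H \<mu> \<eta> w \<longlongrightarrow> 0) (at_right 0)"
    and \<epsilon>: "0 < \<epsilon>"
  obtains t where "0 < t" "t < \<eta>" "\<And>s. 0 < s \<Longrightarrow> s \<le> t \<Longrightarrow> w s * f_eta \<mu> \<eta> w s \<le> \<epsilon> * s"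
proof -
  have "((\<lambda>t. H \<mu> \<eta> w (phi_inv \<mu> \<eta> w t)) \<longlongrightarrow> 0) (at_right 0)"
    by (rule filterlim_compose[OF H phi_inv_tendsto[OF w \<mu>]])
  then have "\<forall>\<^sub>F t in at_right 0. H \<mu> \<eta> w (phi_inv \<mu> \<eta> w t) < \<epsilon>"
    using \<epsilon> by (rule order_tendstoD)
  moreover have "\<forall>\<^sub>F t in at_right 0. t \<in> {0<..<\<eta>}" by (rule eventually_at_right_real[OF \<mu>(2)])
  ultimately have "\<forall>\<^sub>F t in at_right 0. w t * f_eta \<mu> \<eta> w t \<le> \<epsilon> * t"
  proof eventually_elim
    case (elim t)
    then show ?case
      using H_phi_inv[OF w, of t \<eta> \<mu>] \<mu> by (auto simp: divide_less_eq)
  qed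
  then obtain b where b: "b > 0" "\<And>s. 0 < s \<Longrightarrow> s < b \<Longrightarrow> w s * f_eta \<mu> \<eta> w s \<le> \<epsilon> * s"
    unfolding eventually_at_right_field by auto
  show thesis
    by (rule that[of "min b \<eta> / 2"]) (use b \<mu> in auto)
qed

text \<open>An interval on which \<open>f_eta\<close> changes by exactly a factor two. Since \<open>log f_eta\<close> has a derivative
  of modulus \<open>1 / (w f_eta) \<ge> 1 / (\<epsilon> r)\<close>, the length of the interval is at most of order \<open>\<epsilon> a\<close>. The sign
  \<open>\<sigma>\<close> makes \<open>\<sigma> f_eta\<close> increasing: it is \<open>-1\<close> if \<open>1 / w\<close> is not integrable at the origin, and \<open>1\<close>
  otherwise.\<close>

lemma doubling_interval:
  assumes w: "w \<in> weights" and \<mu>: "0 < \<mu>" "0 < \<eta>" and H: "(H \<mu> \<eta> w \<longlongrightarrow> 0) (at_right 0)"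
    and \<epsilon>: "0 < \<epsilon>" "\<epsilon> \<le> 1 / 2"
  obtains a b F \<sigma> where "0 < a" "a < b" "b < \<eta>" "b - a \<le> 2 * \<epsilon> * a" "0 < F" "\<sigma> = 1 \<or> \<sigma> = -1"
    "\<And>r. 0 < r \<Longrightarrow> ((\<lambda>r. \<sigma> * f_eta \<mu> \<eta> w r) has_real_derivative 1 / w r) (at r)"
    "\<sigma> * f_eta \<mu> \<eta> w b - \<sigma> * f_eta \<mu> \<eta> w a = F"
    "\<And>r. r \<in> {a..b} \<Longrightarrow> F \<le> f_eta \<mu> \<eta> w r \<and> f_eta \<mu> \<eta> w r \<le> 2 * F \<and> F * w r \<le> \<epsilon> * r"
proof -
  let ?f = "f_eta \<mu> \<eta> w"
  obtain b where b: "0 < b" "b < \<eta>" "\<And>s. 0 < s \<Longrightarrow> s \<le> b \<Longrightarrow> w s * ?f s \<le> \<epsilon> * s"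
    using weight_small_if_H_tendsto_0[OF w \<mu> H \<epsilon>(1)] by blast
  define \<sigma> where "\<sigma> = (if w \<in> weights_P then -1 else 1 :: real)"
  have \<sigma>: "\<sigma> = 1 \<or> \<sigma> = -1" by (simp add: \<sigma>_def)
  have d: "((\<lambda>r. \<sigma> * ?f r) has_real_derivative 1 / w r) (at r)" if "0 < r" for r
    using DERIV_minus[OF f_eta_P_DERIV[of w r \<eta> \<mu>]] f_eta_Q_DERIV[of w r \<mu> \<eta>] that \<mu>
      weights_Q_iff[OF w]
    by (auto simp: \<sigma>_def)
  have mono: "\<sigma> * ?f s < \<sigma> * ?f t" if "0 < s" "s < t" for s t
    using f_eta_P_less[of w \<eta> s t \<mu>] f_eta_Q_less[of w s t \<mu> \<eta>] that \<mu> weights_Q_iff[OF w]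
    by (auto simp: \<sigma>_def)
  have mono': "\<sigma> * ?f s \<le> \<sigma> * ?f t" if "0 < s" "s \<le> t" for s t
    using mono[of s t] that by (cases "s = t") auto
  have cont: "isCont ?f r" if "0 < r" for r
    using f_eta_P_DERIV[of w r \<eta> \<mu>] f_eta_Q_DERIV[of w r \<mu> \<eta>] that \<mu> weights_Q_iff[OF w]
    by (metis DERIV_isCont)
  have fb: "?f b > 0" using f_eta_pos[OF w b(1) _ \<mu>(1)] b by simp
  obtain a F where a: "0 < a" "a < b" "F > 0" "\<sigma> * ?f b - \<sigma> * ?f a = F"
    and rng: "\<And>r. r \<in> {a..b} \<Longrightarrow> F \<le> ?f r \<and> ?f r \<le> 2 * F"
  proof (cases "w \<in> weights_P")
    case True
    have "\<forall>\<^sub>F t in at_right 0. 2 * ?f b \<le> ?f t"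
      using f_eta_P_at_top[OF True \<mu>(2), of \<mu>] unfolding filterlim_at_top by blast
    moreover have "\<forall>\<^sub>F t in at_right 0. t \<in> {0<..<b}" by (rule eventually_at_right_real[OF b(1)])
    ultimately have "\<forall>\<^sub>F t in at_right 0. 2 * ?f b \<le> ?f t \<and> t \<in> {0<..<b}" by eventually_elim auto
    then obtain t where t: "0 < t" "t < b" "2 * ?f b \<le> ?f t"
      using eventually_happens'[of "at_right (0::real)"] by auto
    obtain a where a: "t \<le> a" "a \<le> b" "?f a = 2 * ?f b"
      using IVT2[of ?f b "2 * ?f b" t] t fb cont by auto
    have "a \<noteq> b" using a fb by auto
    then show thesis
      using that[of a "?f b"] a t fb True mono'[of a] mono'[of _ b] by (auto simp: \<sigma>_def)
  next
    case False
    then have "w \<in> weights_Q" using weights_Q_iff[OF w] by blast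
    then have "\<forall>\<^sub>F t in at_right 0. ?f t < ?f b / 2"
      using fb by (intro order_tendstoD(2)[OF f_eta_Q_tendsto]) auto
    moreover have "\<forall>\<^sub>F t in at_right 0. t \<in> {0<..<b}" by (rule eventually_at_right_real[OF b(1)])
    ultimately have "\<forall>\<^sub>F t in at_right 0. ?f t < ?f b / 2 \<and> t \<in> {0<..<b}" by eventually_elim auto
    then obtain t where t: "0 < t" "t < b" "?f t < ?f b / 2"
      using eventually_happens'[of "at_right (0::real)"] by auto
    obtain a where a: "t \<le> a" "a \<le> b" "?f a = ?f b / 2"
      using IVT[of ?f t "?f b / 2" b] t fb cont by auto
    have "a \<noteq> b" using a fb by auto
    show thesis
    proof (rule that[of a "?f b / 2"])
      show "?f b / 2 \<le> ?f r \<and> ?f r \<le> 2 * (?f b / 2)" if "r \<in> {a..b}" for r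
        using that mono'[of a r] mono'[of r b] a t False by (auto simp: \<sigma>_def)
    qed (use a t fb False \<open>a \<noteq> b\<close> in \<open>auto simp: \<sigma>_def\<close>)
  qed
  have small: "F * w r \<le> \<epsilon> * r" if "r \<in> {a..b}" for r
  proof -
    have "F * w r \<le> ?f r * w r"
      using rng[OF that] weights_pos[OF w, of r] that a by (intro mult_right_mono) auto
    then show ?thesis using b(3)[of r] that a by (simp add: mult.commute)
  qed
  obtain z where z: "a < z" "z < b" "\<sigma> * ?f b - \<sigma> * ?f a = (b - a) * (1 / w z)"
    using MVT2[of a b "\<lambda>r. \<sigma> * ?f r" "\<lambda>r. 1 / w r"] a d by auto
  have "F * w z = b - a" using z a weights_pos[OF w, of z] by (simp add: field_simps)
  then have "b - a \<le> \<epsilon> * z" using small[of z] z by simp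
  also have "\<dots> \<le> \<epsilon> * b" using z \<epsilon> by simp
  finally have ba: "b - a \<le> \<epsilon> * b" .
  also have "\<dots> \<le> 1 / 2 * b" using \<epsilon> a by (intro mult_right_mono) auto
  finally have "b \<le> 2 * a" by simp
  then have "\<epsilon> * b \<le> \<epsilon> * (2 * a)" using \<epsilon> by (intro mult_left_mono) auto
  then have "b - a \<le> 2 * \<epsilon> * a" using ba by simp
  then show thesis
    using that[of a b F \<sigma>] a b \<sigma> d rng small by auto
qed

section \<open>Polynomial radial profiles\<close>

lemma poly_antiderivative:
  fixes q :: "real poly"
  obtains p where "pderiv p = q"
proof
  show "pderiv (\<Sum>i\<le>degree q. monom (coeff q i / real (Suc i)) (Suc i)) = q"
  proof -
    have "pderiv (\<Sum>i\<le>degree q. monom (coeff q i / real (Suc i)) (Suc i))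
        = (\<Sum>i\<le>degree q. monom (coeff q i) i)"
      
      unfolding sum_comp_morphism[of pderiv, OF pderiv_0 pderiv_add, symmetric]
      by (intro sum.cong refl) (simp add: pderiv_monom)
    then show ?thesis by (simp add: poly_as_sum_of_monoms)
  qed
qed

text \<open>A positive continuous function is comparable to the square of a polynomial, by Weierstrass
  approximation of its square root. A square is used because it is nonnegative on the whole line.\<close>

lemma poly_square_between:
  fixes k :: "real \<Rightarrow> real"
  assumes ab: "a \<le> b" and k: "continuous_on {a..b} k" "\<And>s. s \<in> {a..b} \<Longrightarrow> 0 < k s"
  obtains q :: "real poly" where "\<And>s. s \<in> {a..b} \<Longrightarrow> k s / 2 \<le> (poly q s)\<^sup>2 \<and> (poly q s)\<^sup>2 \<le> k s"
proof -
  have c: "continuous_on {a..b} (\<lambda>s. sqrt (k s))" using k by (intro continuous_intros)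
  obtain z where z: "z \<in> {a..b}" "\<And>s. s \<in> {a..b} \<Longrightarrow> sqrt (k z) \<le> sqrt (k s)"
    using continuous_attains_inf[OF _ _ c] ab by auto
  have e: "0 < sqrt (k z) / 10" using k(2)[OF z(1)] by simp
  obtain g where g: "real_polynomial_function g"
    "\<And>s. s \<in> {a..b} \<Longrightarrow> \<bar>17 / 20 * sqrt (k s) - g s\<bar> < sqrt (k z) / 10"
    by (rule Stone_Weierstrass_real_polynomial_function[of "{a..b}" "\<lambda>s. 17 / 20 * sqrt (k s)", OF _ _ e])
      (use c in \<open>auto intro!: continuous_intros\<close>)
  obtain c n where cn: "g = (\<lambda>x. \<Sum>i\<le>n. c i * x ^ i)"
    using g(1) real_polynomial_function_iff_sum by blast
  define q where "q = (\<Sum>i\<le>n. monom (c i) i)"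
  have q: "poly q s = g s" for s by (simp add: q_def poly_sum poly_monom cn)
  show thesis
  proof
    fix s assume s: "s \<in> {a..b}"
    let ?r = "sqrt (k s)"
    have r: "0 < ?r" using k(2)[OF s] by simp
    have "\<bar>17 / 20 * ?r - g s\<bar> < ?r / 10" using g(2)[OF s] z(2)[OF s] by linarith
    \<comment> \<open>\<open>17/20 - 1/10 = 3/4\<close>, whose square is at least \<open>1/2\<close>, and \<open>17/20 + 1/10 \<le> 1\<close>.\<close>
    then have gs: "3 / 4 * ?r \<le> g s" "g s \<le> ?r" using r by (auto simp: abs_if split: if_splits)
    have "(3 / 4 * ?r)\<^sup>2 \<le> (g s)\<^sup>2" "(g s)\<^sup>2 \<le> ?r\<^sup>2"
      using gs r by (intro power_mono; linarith)+
    then show "k s / 2 \<le> (poly q s)\<^sup>2 \<and> (poly q s)\<^sup>2 \<le> k s"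
      using k(2)[OF s] by (simp add: q power_mult_distrib power2_eq_square)
  qed
qed

text \<open>A smooth substitute for the radial variable \<open>\<Phi>\<close>, which itself is only twice continuously
  differentiable: a polynomial in \<open>r\<^sup>2\<close> that increases from 0 to 1 on the interval from \<open>a\<close> to \<open>b\<close> at a
  speed of at most twice that of \<open>(\<Phi> - \<Phi> a) / F\<close>. It is monotone on the whole line, so its composition with
  \<open>bump\<close> vanishes outside the interval. Its middle half covers at least a quarter of the range of
  \<open>\<Phi>\<close>.\<close>

lemma radial_profile:
  fixes k \<Phi> :: "real \<Rightarrow> real"
  assumes ab: "0 < a" "a < b" and k: "continuous_on {a..b} k" "\<And>r. r \<in> {a..b} \<Longrightarrow> 0 < k r"
    and \<Phi>: "\<And>r. r \<in> {a..b} \<Longrightarrow> (\<Phi> has_real_derivative k r) (at r)" "\<Phi> b - \<Phi> a = F" and F: "0 < F"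
  obtains P :: "real poly" and a' b' where
    "a \<le> a'" "a' \<le> b'" "b' \<le> b" "F / 4 \<le> \<Phi> b' - \<Phi> a'"
    "\<And>s. s \<le> a\<^sup>2 \<Longrightarrow> poly P s \<le> 0" "\<And>s. b\<^sup>2 \<le> s \<Longrightarrow> 1 \<le> poly P s"
    "\<And>r. r \<in> {a..b} \<Longrightarrow> 0 \<le> 2 * r * poly (pderiv P) (r\<^sup>2) \<and> 2 * r * poly (pderiv P) (r\<^sup>2) \<le> 2 * k r / F"
    "\<And>r. r \<in> {a'..b'} \<Longrightarrow> 1 / 4 \<le> poly P (r\<^sup>2) \<and> poly P (r\<^sup>2) \<le> 3 / 4"
proof -
  have sq: "a\<^sup>2 \<le> b\<^sup>2" using ab by (intro power_mono) auto
  have rt: "sqrt s \<in> {a..b}" if "s \<in> {a\<^sup>2..b\<^sup>2}" for s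
    using that ab by (auto intro: real_le_rsqrt real_le_lsqrt)
  \<comment> \<open>In the variable \<open>s = r\<^sup>2\<close> the derivative \<open>k\<close> becomes \<open>k (sqrt s) / (2 * sqrt s)\<close>.\<close>
  have "continuous_on {a\<^sup>2..b\<^sup>2} (\<lambda>s. k (sqrt s))"
    by (rule continuous_on_compose2[OF k(1)]) (use rt in \<open>auto intro!: continuous_intros\<close>)
  then have "continuous_on {a\<^sup>2..b\<^sup>2} (\<lambda>s. k (sqrt s) / (2 * sqrt s))"
    using rt ab by (intro continuous_intros) force+
  moreover have "0 < k (sqrt s) / (2 * sqrt s)" if "s \<in> {a\<^sup>2..b\<^sup>2}" for s
  proof -
    have "0 < sqrt s" using rt[OF that] ab unfolding atLeastAtMost_iff by linarith
    then show ?thesis using k(2)[OF rt[OF that]] by (intro divide_pos_pos) auto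
  qed
  ultimately obtain q where q: "\<And>s. s \<in> {a\<^sup>2..b\<^sup>2} \<Longrightarrow>
      k (sqrt s) / (2 * sqrt s) / 2 \<le> (poly q s)\<^sup>2 \<and> (poly q s)\<^sup>2 \<le> k (sqrt s) / (2 * sqrt s)"
    using poly_square_between[OF sq, of "\<lambda>s. k (sqrt s) / (2 * sqrt s)"] by blast
  obtain P0 where P0: "pderiv P0 = q * q" using poly_antiderivative by blast
  have dP0: "(poly P0 has_real_derivative (poly q s)\<^sup>2) (at s)" for s
    using poly_DERIV[of P0 s] by (simp add: P0 power2_eq_square)
  have P0_mono: "poly P0 s \<le> poly P0 t" if "s \<le> t" for s t
    by (rule DERIV_nonneg_imp_nondecreasing[OF that]) (use dP0 zero_le_power2 in blast)
  define N where "N r = poly P0 (r\<^sup>2) - poly P0 (a\<^sup>2)" for r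
  define n where "n r = 2 * r * (poly q (r\<^sup>2))\<^sup>2" for r
  have dN: "(N has_real_derivative n r) (at r)" for r
    unfolding N_def[abs_def] n_def
    by (auto intro!: derivative_eq_intros simp: P0 power2_eq_square)
  have n: "k r / 2 \<le> n r" "n r \<le> k r" if "r \<in> {a..b}" for r
  proof -
    have "r\<^sup>2 \<in> {a\<^sup>2..b\<^sup>2}" "sqrt (r\<^sup>2) = r" using that ab by (auto intro!: power_mono)
    then have "k r / (2 * r) / 2 \<le> (poly q (r\<^sup>2))\<^sup>2 \<and> (poly q (r\<^sup>2))\<^sup>2 \<le> k r / (2 * r)"
      using q[of "r\<^sup>2"] by simp
    then show "k r / 2 \<le> n r" "n r \<le> k r"
      using that ab by (auto simp: n_def field_simps)
  qed
  have \<Phi>N: "N t - N s \<le> \<Phi> t - \<Phi> s" "(\<Phi> t - \<Phi> s) / 2 \<le> N t - N s" if "a \<le> s" "s \<le> t" "t \<le> b" for s t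
  proof -
    have "\<Phi> s - N s \<le> \<Phi> t - N t"
    proof (rule DERIV_nonneg_imp_nondecreasing[of s t "\<lambda>r. \<Phi> r - N r", OF that(2)])
      fix r assume "s \<le> r" "r \<le> t"
      then have r: "r \<in> {a..b}" using that by auto
      show "\<exists>y. ((\<lambda>r. \<Phi> r - N r) has_real_derivative y) (at r) \<and> 0 \<le> y"
        by (rule exI[of _ "k r - n r"]) (use n[OF r] DERIV_diff[OF \<Phi>(1)[OF r] dN] in auto)
    qed
    moreover have "N s - \<Phi> s / 2 \<le> N t - \<Phi> t / 2"
    proof (rule DERIV_nonneg_imp_nondecreasing[of s t "\<lambda>r. N r - \<Phi> r / 2", OF that(2)])
      fix r assume "s \<le> r" "r \<le> t"
      then have r: "r \<in> {a..b}" using that by auto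
      show "\<exists>y. ((\<lambda>r. N r - \<Phi> r / 2) has_real_derivative y) (at r) \<and> 0 \<le> y"
        by (rule exI[of _ "n r - k r / 2"]) (use n[OF r] DERIV_diff[OF dN DERIV_cdivide[OF \<Phi>(1)[OF r]]] in auto)
    qed
    ultimately show "N t - N s \<le> \<Phi> t - \<Phi> s" "(\<Phi> t - \<Phi> s) / 2 \<le> N t - N s" by (simp_all add: field_simps)
  qed
  define L where "L = N b"
  have Na: "N a = 0" by (simp add: N_def)
  have L: "F / 2 \<le> L" using \<Phi>N(2)[of a b] ab \<Phi>(2) Na by (simp add: L_def)
  then have L0: "0 < L" using F by simp
  have N_mono: "N s \<le> N t" if "0 \<le> s" "s \<le> t" for s t
    using P0_mono[of "s\<^sup>2" "t\<^sup>2"] that by (simp add: N_def power_mono)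
  have contN: "isCont N r" for r using dN DERIV_isCont by blast
  obtain a' where a': "a \<le> a'" "a' \<le> b" "N a' = L / 4"
    using IVT[of N a "L / 4" b] Na L0 ab contN by (auto simp: L_def)
  obtain b' where b': "a' \<le> b'" "b' \<le> b" "N b' = 3 * L / 4"
    using IVT[of N a' "3 * L / 4" b] a' L0 contN by (auto simp: L_def)
  define P where "P = smult (1 / L) (P0 - [:poly P0 (a\<^sup>2):])"
  have P: "poly P s = (poly P0 s - poly P0 (a\<^sup>2)) / L" for s by (simp add: P_def)
  have PN: "poly P (r\<^sup>2) = N r / L" for r by (simp add: P N_def)
  have dP: "poly (pderiv P) s = (poly q s)\<^sup>2 / L" for s
    by (simp add: P_def pderiv_smult pderiv_diff P0 power2_eq_square pderiv_pCons)
  show thesis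
  proof (rule that[where P = P and a' = a' and b' = b'])
    show "F / 4 \<le> \<Phi> b' - \<Phi> a'" using \<Phi>N(1)[of a' b'] a' b' L by simp
    show "poly P s \<le> 0" if "s \<le> a\<^sup>2" for s
      using P0_mono[OF that] L0 by (simp add: P divide_nonpos_pos)
    show "1 \<le> poly P s" if "b\<^sup>2 \<le> s" for s
      using P0_mono[OF that] L0 by (simp add: P L_def N_def)
    show "0 \<le> 2 * r * poly (pderiv P) (r\<^sup>2) \<and> 2 * r * poly (pderiv P) (r\<^sup>2) \<le> 2 * k r / F"
      if r: "r \<in> {a..b}" for r
    proof
      have eq: "2 * r * poly (pderiv P) (r\<^sup>2) = n r / L" by (simp add: dP n_def)
      show "0 \<le> 2 * r * poly (pderiv P) (r\<^sup>2)" using eq n[OF r] k(2)[OF r] L0 by simp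
      have "n r / L \<le> k r / (F / 2)"
        using n[OF r] k(2)[OF r] L F by (intro frac_le) auto
      then show "2 * r * poly (pderiv P) (r\<^sup>2) \<le> 2 * k r / F" unfolding eq by (simp add: mult.commute)
    qed
    show "1 / 4 \<le> poly P (r\<^sup>2) \<and> poly P (r\<^sup>2) \<le> 3 / 4" if "r \<in> {a'..b'}" for r
      using N_mono[of a' r] N_mono[of r b'] that a' b' ab L0 by (simp add: PN field_simps)
  qed (use a' b' in auto)
qed

section \<open>Test functions concentrated near a point\<close>

text \<open>The test function: a radial bump with profile \<open>P\<close>, cut off to the ball of radius \<open>\<delta>\<close> around \<open>c\<close>. Both
  arguments of \<open>bump\<close> are polynomials on the whole space, so smoothness needs no case distinction at the
  origin. The second argument is \<open>1/2\<close> at the centre and \<open>1\<close> on the boundary of the ball.\<close>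

definition test_fun :: "real poly \<Rightarrow> 'a::real_inner \<Rightarrow> real \<Rightarrow> 'a \<Rightarrow> real"
  where "test_fun P c \<delta> x = bump (poly P (x \<bullet> x)) * bump (1 / 2 + (x - c) \<bullet> (x - c) / (2 * \<delta>\<^sup>2))"

lemma Ck_test_fun: "Ck k (test_fun P c \<delta>)"
proof -
  have "Ck k (\<lambda>x. bump (poly P (x \<bullet> x)) * bump (1 / 2 + (x - c) \<bullet> (x - c) * (1 / (2 * \<delta>\<^sup>2))))"
    by (intro Ck_mult Ck_bump Ck_compose_smooth[OF smooth_poly] Ck_inner_self Ck_add Ck_const
        Ck_dist_square)
  then show ?thesis by (simp add: test_fun_def[abs_def])
qed

lemma gradient_eqI:
  assumes "GDERIV u x :> D" shows "gradient u x = D"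
  unfolding gradient_def
proof (rule the_equality)
  show "GDERIV u x :> D" by fact
  fix D' assume "GDERIV u x :> D'"
  then have "(\<lambda>h. h \<bullet> D') = (\<lambda>h. h \<bullet> D)"
    using assms unfolding gderiv_def by (rule has_derivative_unique)
  then have "(D' - D) \<bullet> D' = (D' - D) \<bullet> D" by meson
  then have "(D' - D) \<bullet> (D' - D) = 0" by (simp add: inner_diff_right)
  then show "D' = D" by simp
qed

lemma GDERIV_dist_square: "GDERIV (\<lambda>x. (x - c) \<bullet> (x - c)) x :> 2 *\<^sub>R (x - c)"
proof -
  have d: "((\<lambda>x. x - c) has_derivative (\<lambda>h. h)) (at x)"
    using has_derivative_diff[OF has_derivative_ident has_derivative_const[of c]] by simp
  show ?thesis
    unfolding gderiv_def using has_derivative_inner[OF d d]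
    by (simp add: inner_commute algebra_simps)
qed

lemma gradient_test_fun:
  assumes b': "\<And>t. (bump has_real_derivative b' t) (at t)"
  shows "gradient (test_fun P c \<delta>) x =
    bump (poly P (x \<bullet> x)) *\<^sub>R (b' (1 / 2 + (x - c) \<bullet> (x - c) / (2 * \<delta>\<^sup>2)) / \<delta>\<^sup>2) *\<^sub>R (x - c)
    + bump (1 / 2 + (x - c) \<bullet> (x - c) / (2 * \<delta>\<^sup>2)) *\<^sub>R
        (b' (poly P (x \<bullet> x)) * (2 * poly (pderiv P) (x \<bullet> x))) *\<^sub>R x"
proof (rule gradient_eqI, unfold test_fun_def[abs_def], rule GDERIV_mult)
  have "GDERIV (\<lambda>x. poly P (x \<bullet> x)) x :> poly (pderiv P) (x \<bullet> x) *\<^sub>R 2 *\<^sub>R x"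
    using GDERIV_DERIV_compose[OF GDERIV_dist_square[of 0 x]] poly_DERIV[of P "x \<bullet> x"] by simp
  from GDERIV_DERIV_compose[OF this b']
  show "GDERIV (\<lambda>x. bump (poly P (x \<bullet> x))) x :>
      (b' (poly P (x \<bullet> x)) * (2 * poly (pderiv P) (x \<bullet> x))) *\<^sub>R x"
    by (simp add: mult.commute mult.left_commute)
  have "((\<lambda>s. bump (1 / 2 + s / (2 * \<delta>\<^sup>2))) has_real_derivative
      b' (1 / 2 + s / (2 * \<delta>\<^sup>2)) / (2 * \<delta>\<^sup>2)) (at s)" for s
    using DERIV_chain2[OF b' DERIV_add[OF DERIV_const DERIV_cdivide[OF DERIV_ident]],
        of "1 / 2" "2 * \<delta>\<^sup>2" s UNIV] by simp
  from GDERIV_DERIV_compose[OF GDERIV_dist_square[of c x] this]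
  show "GDERIV (\<lambda>x. bump (1 / 2 + (x - c) \<bullet> (x - c) / (2 * \<delta>\<^sup>2))) x :>
      (b' (1 / 2 + (x - c) \<bullet> (x - c) / (2 * \<delta>\<^sup>2)) / \<delta>\<^sup>2) *\<^sub>R (x - c)"
    by (simp add: field_simps)
qed

lemma test_fun_mem_test_functions:
  fixes c :: "'a::euclidean_space"
  assumes ab: "0 < a" "a < b" "b < \<eta>"
    and P: "\<And>s. s \<le> a\<^sup>2 \<Longrightarrow> poly P s \<le> 0" "\<And>s. b\<^sup>2 \<le> s \<Longrightarrow> 1 \<le> poly P s"
  shows "test_fun P c \<delta> \<in> test_functions (ball 0 \<eta> - {0})"
    and "test_fun P c \<delta> x \<noteq> 0 \<Longrightarrow> a \<le> norm x \<and> norm x \<le> b"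
proof -
  have nz: "a \<le> norm x \<and> norm x \<le> b" if "test_fun P c \<delta> x \<noteq> 0" for x
  proof (rule ccontr)
    assume "\<not> (a \<le> norm x \<and> norm x \<le> b)"
    then have "(norm x)\<^sup>2 \<le> a\<^sup>2 \<or> b\<^sup>2 \<le> (norm x)\<^sup>2"
      using ab by (auto intro!: power_mono simp: not_le less_imp_le)
    then have "bump (poly P (x \<bullet> x)) = 0"
      using P(1)[of "x \<bullet> x"] P(2)[of "x \<bullet> x"] by (auto simp: power2_norm_eq_inner bump_eq)
    then show False using that by (simp add: test_fun_def)
  qed
  show "test_fun P c \<delta> x \<noteq> 0 \<Longrightarrow> a \<le> norm x \<and> norm x \<le> b" by (rule nz)
  have "closed {x::'a. a \<le> norm x \<and> norm x \<le> b}"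
    by (intro closed_Collect_conj closed_Collect_le continuous_intros)
  then have sub: "closure {x. test_fun P c \<delta> x \<noteq> 0} \<subseteq> {x. a \<le> norm x \<and> norm x \<le> b}"
    by (intro closure_minimal) (use nz in auto)
  moreover have "bounded (closure {x. test_fun P c \<delta> x \<noteq> 0})"
    by (rule bounded_subset[OF bounded_cball[of 0 b]]) (use sub in auto)
  ultimately show "test_fun P c \<delta> \<in> test_functions (ball 0 \<eta> - {0})"
    using ab unfolding test_functions_def
    by (auto simp: Ck_test_fun compact_eq_bounded_closed)
qed

lemma norm_gradient_test_fun_le:
  fixes c :: "'a::euclidean_space"
  assumes b': "\<And>t. (bump has_real_derivative b' t) (at t)" "\<And>t. \<bar>b' t\<bar> \<le> K"
      "\<And>t. t \<le> 0 \<or> 1 \<le> t \<Longrightarrow> b' t = 0" and \<delta>: "0 < \<delta>"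
    and P': "0 \<le> norm x * poly (pderiv P) (x \<bullet> x)"
  shows "norm (gradient (test_fun P c \<delta>) x) \<le> K / \<delta> + K * (2 * norm x * poly (pderiv P) (x \<bullet> x))"
    and "poly P (x \<bullet> x) \<le> 0 \<or> 1 \<le> poly P (x \<bullet> x) \<or> \<delta> \<le> norm (x - c) \<Longrightarrow>
      gradient (test_fun P c \<delta>) x = 0"
proof -
  let ?B = "1 / 2 + (x - c) \<bullet> (x - c) / (2 * \<delta>\<^sup>2)"
  have K: "0 \<le> K" using b'(2)[of 0] by linarith
  have B: "1 \<le> ?B" if "\<delta> \<le> norm (x - c)"
  proof -
    have "\<delta>\<^sup>2 \<le> (x - c) \<bullet> (x - c)"
      using power_mono[OF that, of 2] \<delta> by (simp add: power2_norm_eq_inner)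
    then show ?thesis using \<delta> by (simp add: field_simps)
  qed
  show "gradient (test_fun P c \<delta>) x = 0"
    if "poly P (x \<bullet> x) \<le> 0 \<or> 1 \<le> poly P (x \<bullet> x) \<or> \<delta> \<le> norm (x - c)"
    unfolding gradient_test_fun[OF b'(1)] using that B b'(3) by (auto simp: bump_eq)
  have "\<bar>b' ?B\<bar> * norm (x - c) \<le> K * \<delta>"
  proof (cases "\<delta> \<le> norm (x - c)")
    case True
    then show ?thesis using B b'(3)[of ?B] K \<delta> by simp
  next
    case False
    then show ?thesis using b'(2) K by (intro mult_mono) auto
  qed
  then have 1: "\<bar>b' ?B\<bar> / \<delta>\<^sup>2 * norm (x - c) \<le> K / \<delta>"
    using \<delta> by (simp add: field_simps power2_eq_square)
  have "norm (bump (poly P (x \<bullet> x)) *\<^sub>R (b' ?B / \<delta>\<^sup>2) *\<^sub>R (x - c)) \<le> 1 * (K / \<delta>)"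
    unfolding norm_scaleR[of "bump _"]
    by (rule mult_mono) (use 1 in \<open>auto simp: bump_nonneg bump_le_1\<close>)
  moreover have "norm (bump ?B *\<^sub>R (b' (poly P (x \<bullet> x)) * (2 * poly (pderiv P) (x \<bullet> x))) *\<^sub>R x)
      \<le> 1 * (K * (2 * norm x * poly (pderiv P) (x \<bullet> x)))"
    unfolding norm_scaleR[of "bump _"]
  proof (rule mult_mono)
    have "norm ((b' (poly P (x \<bullet> x)) * (2 * poly (pderiv P) (x \<bullet> x))) *\<^sub>R x)
        = \<bar>b' (poly P (x \<bullet> x))\<bar> * \<bar>2 * (norm x * poly (pderiv P) (x \<bullet> x))\<bar>"
      by (simp add: abs_mult)
    also have "\<dots> = \<bar>b' (poly P (x \<bullet> x))\<bar> * (2 * norm x * poly (pderiv P) (x \<bullet> x))"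
      using P' by simp
    also have "\<dots> \<le> K * (2 * norm x * poly (pderiv P) (x \<bullet> x))"
      using P' b'(2) by (intro mult_right_mono) auto
    finally show "norm ((b' (poly P (x \<bullet> x)) * (2 * poly (pderiv P) (x \<bullet> x))) *\<^sub>R x)
        \<le> K * (2 * norm x * poly (pderiv P) (x \<bullet> x))" .
  qed (auto simp: bump_nonneg bump_le_1)
  ultimately show "norm (gradient (test_fun P c \<delta>) x) \<le> K / \<delta> + K * (2 * norm x * poly (pderiv P) (x \<bullet> x))"
    unfolding gradient_test_fun[OF b'(1)] by (intro norm_triangle_le) simp
qed

lemma test_fun_ge:
  assumes "1 / 4 \<le> poly P (x \<bullet> x)" "poly P (x \<bullet> x) \<le> 3 / 4" "norm (x - c) \<le> \<delta> / 4" "0 < \<delta>"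
  shows "exp (-16) \<le> test_fun P c \<delta> x"
proof -
  have "(x - c) \<bullet> (x - c) \<le> (\<delta> / 4)\<^sup>2"
    using power_mono[OF assms(3), of 2] by (simp add: power2_norm_eq_inner)
  also have "\<dots> \<le> 1 / 4 * (2 * \<delta>\<^sup>2)" by (simp add: power_divide)
  finally have "(x - c) \<bullet> (x - c) / (2 * \<delta>\<^sup>2) \<le> 1 / 4"
    using assms(4) by (intro iffD2[OF pos_divide_le_eq]) auto
  then have "exp (-8) \<le> bump (1 / 2 + (x - c) \<bullet> (x - c) / (2 * \<delta>\<^sup>2))"
    using assms(4) by (intro bump_lower) auto
  moreover have "exp (-8) \<le> bump (poly P (x \<bullet> x))" using assms by (intro bump_lower) auto
  ultimately have "exp (-8) * exp (-8) \<le> test_fun P c \<delta> x"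
    unfolding test_fun_def by (intro mult_mono) (auto simp: bump_nonneg)
  then show ?thesis by (simp add: exp_add[symmetric])
qed

section \<open>Energy estimates\<close>

text \<open>For small \<open>\<epsilon>\<close> there is a test function whose energy is at most of order
  \<open>F powr (1 - p)\<close> times the volume of a cone of opening \<open>32 \<epsilon>\<close>, whereas its weighted integral is at least
  of order \<open>F powr (- s)\<close> times the volume of a cone of opening \<open>\<epsilon>\<close>. On the support, the radial part
  of the gradient is at most of order \<open>1 / (w F)\<close>, and so is the part from the cut-off at scale
  \<open>\<delta> = 16 \<epsilon> a\<close>, because \<open>w F \<le> \<epsilon> r\<close>. The powers of \<open>w\<close> then combine to \<open>1 / w\<close> in both integrals,
  and \<open>1 / w\<close> has integral \<open>F\<close> over the radial interval.\<close>

lemma test_function_estimate: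
  fixes e :: "'a::euclidean_space" and w :: "real \<Rightarrow> real" and p q s \<mu> \<eta> \<epsilon> K :: real
  assumes w: "w \<in> weights" and \<mu>: "0 < \<mu>" "0 < \<eta>" and H: "(H \<mu> \<eta> w \<longlongrightarrow> 0) (at_right 0)"
    and \<epsilon>: "0 < \<epsilon>" "\<epsilon> \<le> 1 / 2" and e: "norm e = 1" and p: "1 < p" and q: "0 < q" and s: "0 < s"
    and b': "\<And>t. (bump has_real_derivative b' t) (at t)" "\<And>t. \<bar>b' t\<bar> \<le> K" "1 \<le> K"
      "\<And>t. t \<le> 0 \<or> 1 \<le> t \<Longrightarrow> b' t = 0"
  obtains u F where "u \<in> test_functions (ball (0 :: 'a) \<eta> - {0})" "0 < F"
    "(LINT x:ball 0 \<eta>|lborel. norm (gradient u x) powr p * w (norm x) powr (p - 1)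
        * norm x powr (1 - real DIM('a)))
      \<le> (4 * K) powr p * DIM('a) * F powr (1 - p) * cone_vol e (32 * \<epsilon>)"
    "exp (-16) powr q * 2 powr (- (1 + s)) * DIM('a) / 4 * F powr (- s) * cone_vol e \<epsilon>
      \<le> (LINT x:ball 0 \<eta>|lborel. \<bar>u x\<bar> powr q * norm x powr (1 - real DIM('a))
          / (w (norm x) * f_eta \<mu> \<eta> w (norm x) powr (1 + s)))"
proof -
  let ?f = "f_eta \<mu> \<eta> w" and ?d = "real DIM('a)"
  obtain a b F \<sigma> where ab: "0 < a" "a < b" "b < \<eta>" "b - a \<le> 2 * \<epsilon> * a"
    and F: "0 < F" and \<sigma>: "\<sigma> = 1 \<or> \<sigma> = -1"
    and \<Phi>: "\<And>r. 0 < r \<Longrightarrow> ((\<lambda>r. \<sigma> * ?f r) has_real_derivative 1 / w r) (at r)"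
      "\<sigma> * ?f b - \<sigma> * ?f a = F"
    and rng: "\<And>r. r \<in> {a..b} \<Longrightarrow> F \<le> ?f r \<and> ?f r \<le> 2 * F \<and> F * w r \<le> \<epsilon> * r"
    by (rule doubling_interval[OF w \<mu> H \<epsilon>]) (rule that; assumption)
  define \<Phi> where "\<Phi> r = \<sigma> * ?f r" for r
  have k: "continuous_on {a..b} (\<lambda>r. 1 / w r)" "\<And>r. r \<in> {a..b} \<Longrightarrow> 0 < 1 / w r"
    using ab weights_pos[OF w] by (auto intro!: weights_continuous_on_inverse[OF w])
  have d\<Phi>: "(\<Phi> has_real_derivative 1 / w r) (at r)" if "r \<in> {a..b}" for r
    using \<Phi>(1)[of r] that ab by (simp add: \<Phi>_def[abs_def])
  then have d\<Phi>_ball: "\<forall>r\<in>{a..b}. (\<Phi> has_real_derivative 1 / w r) (at r)" by blast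
  have wn: "0 < w r" if "r \<in> {a..b}" for r
    using weights_pos[OF w, of r] that ab by simp
  have \<Phi>F: "\<Phi> b - \<Phi> a = F" using \<Phi>(2) by (simp add: \<Phi>_def)
  obtain P a' r' where a': "a \<le> a'" "a' \<le> r'" "r' \<le> b" "F / 4 \<le> \<Phi> r' - \<Phi> a'"
    and P: "\<And>s. s \<le> a\<^sup>2 \<Longrightarrow> poly P s \<le> 0" "\<And>s. b\<^sup>2 \<le> s \<Longrightarrow> 1 \<le> poly P s"
    and P': "\<And>r. r \<in> {a..b} \<Longrightarrow> 0 \<le> 2 * r * poly (pderiv P) (r\<^sup>2) \<and>
        2 * r * poly (pderiv P) (r\<^sup>2) \<le> 2 * (1 / w r) / F"
    and Pm: "\<And>r. r \<in> {a'..r'} \<Longrightarrow> 1 / 4 \<le> poly P (r\<^sup>2) \<and> poly P (r\<^sup>2) \<le> 3 / 4"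
    by (rule radial_profile[OF ab(1,2) k d\<Phi> \<Phi>F F]; (assumption | (rule that; assumption)))
  \<comment> \<open>The ball of radius \<open>\<delta>\<close> lies in the cone of opening \<open>2 \<delta> / a = 32 \<epsilon>\<close> where \<open>norm x \<ge> a\<close>, and the
    ball of radius \<open>\<delta> / 4 = 4 \<epsilon> a\<close> contains the cone of opening \<open>\<epsilon>\<close> where \<open>a \<le> norm x \<le> b\<close>.\<close>
  define \<delta> where "\<delta> = 16 * \<epsilon> * a"
  have \<delta>: "0 < \<delta>" using \<epsilon> ab by (simp add: \<delta>_def)
  have "2 * \<epsilon> * a \<le> 1 * a" using \<epsilon> ab by (intro mult_right_mono) auto
  then have b2a: "b \<le> 2 * a" using ab(4) by linarith
  define u where "u = test_fun P (a *\<^sub>R e) \<delta>"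
  have u: "u \<in> test_functions (ball 0 \<eta> - {0})"
    unfolding u_def by (intro test_fun_mem_test_functions(1)[OF ab(1-3)] P)
  define An where "An = {x::'a. a \<le> norm x \<and> norm x \<le> b}"
  have An: "norm x \<in> {a..b}" "x \<bullet> x = (norm x)\<^sup>2" if "x \<in> An" for x
    using that by (auto simp: An_def power2_norm_eq_inner)
  have P'_nonneg: "0 \<le> norm x * poly (pderiv P) (x \<bullet> x)" if "x \<in> An" for x
  proof -
    have "0 \<le> 2 * (norm x * poly (pderiv P) (x \<bullet> x))"
      using P'[OF An(1)[OF that]] An(2)[OF that] by (simp only: mult.assoc)
    then show ?thesis by linarith
  qed
  have grad0: "gradient u x = 0" if "x \<notin> cone_at e (32 * \<epsilon>) \<inter> An" for x
  proof (cases "x \<in> An")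
    case True
    then have nx: "norm x \<in> {a..b}" "a \<le> norm x" by (auto simp: An_def)
    have "\<delta> \<le> norm (x - a *\<^sub>R e)"
    proof (rule ccontr)
      assume "\<not> \<delta> \<le> norm (x - a *\<^sub>R e)"
      then have "norm (x - norm x *\<^sub>R e) \<le> 2 * \<delta>"
        using norm_diff_axis_le(2)[OF e, of a x] ab by simp
      also have "\<dots> \<le> 32 * \<epsilon> * norm x"
        using mult_left_mono[OF nx(2), of "32 * \<epsilon>"] \<epsilon> unfolding \<delta>_def by simp
      finally show False using that True by (simp add: cone_at_def)
    qed
    then have "poly P (x \<bullet> x) \<le> 0 \<or> 1 \<le> poly P (x \<bullet> x) \<or> \<delta> \<le> norm (x - a *\<^sub>R e)"
      by blast
    then show ?thesis
      unfolding u_def by (intro norm_gradient_test_fun_le(2)[OF b'(1,2) _ \<delta> P'_nonneg[OF True]] b'(4))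
  next
    case False
    then have "norm x < a \<or> b < norm x" by (auto simp: An_def)
    then have "(norm x)\<^sup>2 \<le> a\<^sup>2 \<or> b\<^sup>2 \<le> (norm x)\<^sup>2"
      using ab by (auto intro!: power_mono)
    then have z: "poly P (x \<bullet> x) \<le> 0 \<or> 1 \<le> poly P (x \<bullet> x)"
      using P by (auto simp: power2_norm_eq_inner)
    then show ?thesis
      unfolding u_def gradient_test_fun[OF b'(1)] using b'(4) by (auto simp: bump_eq)
  qed
  have grad: "norm (gradient u x) \<le> 4 * K / F * (1 / w (norm x))" if x: "x \<in> An" for x
  proof -
    have r: "norm x \<in> {a..b}" and xx: "x \<bullet> x = (norm x)\<^sup>2" using An[OF x] by auto
    have wx: "0 < w (norm x)" using wn[OF r] .
    have "norm (gradient u x) \<le> K / \<delta> + K * (2 * norm x * poly (pderiv P) (x \<bullet> x))"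
      unfolding u_def by (intro norm_gradient_test_fun_le(1)[OF b'(1,2) _ \<delta> P'_nonneg[OF x]] b'(4))
    also have "K * (2 * norm x * poly (pderiv P) (x \<bullet> x)) \<le> K * (2 * (1 / w (norm x)) / F)"
      using P'[OF r] xx b'(3) by (intro mult_left_mono) auto
    also have "K / \<delta> \<le> K * (1 / w (norm x) / F)"
    proof -
      have "F * w (norm x) \<le> \<epsilon> * norm x" using rng[OF r] by simp
      also have "\<dots> \<le> \<epsilon> * (2 * a)" using r b2a \<epsilon> by (intro mult_left_mono) auto
      also have "\<dots> \<le> \<delta>" using \<epsilon> ab by (simp add: \<delta>_def)
      finally have "1 / \<delta> \<le> 1 / (F * w (norm x))" using F wx \<delta> by (intro divide_left_mono) auto
      then have "K * (1 / \<delta>) \<le> K * (1 / (F * w (norm x)))" using b'(3) by (intro mult_left_mono) auto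
      then show ?thesis by (simp add: mult.commute)
    qed
    also have "K * (1 / w (norm x) / F) + K * (2 * (1 / w (norm x)) / F) \<le> 4 * K / F * (1 / w (norm x))"
    proof -
      define X where "X = K * (1 / w (norm x) / F)"
      have "0 \<le> X" using b'(3) F wx by (simp add: X_def)
      moreover have "K * (2 * (1 / w (norm x)) / F) = 2 * X" "4 * K / F * (1 / w (norm x)) = 4 * X"
        by (simp_all add: X_def)
      ultimately show ?thesis unfolding X_def[symmetric] by linarith
    qed
    finally show ?thesis by simp
  qed
  have upper: "(LINT x:ball 0 \<eta>|lborel. norm (gradient u x) powr p * w (norm x) powr (p - 1)
        * norm x powr (1 - ?d)) \<le> (4 * K) powr p * DIM('a) * F powr (1 - p) * cone_vol e (32 * \<epsilon>)"
  proof -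
    let ?S = "cone_at e (32 * \<epsilon>) \<inter> {x. a \<le> norm x \<and> norm x \<le> b}"
    let ?c = "(4 * K / F) powr p"
    note int = cone_annulus_integral[OF ab(1) less_imp_le[OF ab(2)] k(1) d\<Phi>_ball, of e "32 * \<epsilon>"]
    have "(LINT x:ball 0 \<eta>|lborel. norm (gradient u x) powr p * w (norm x) powr (p - 1)
        * norm x powr (1 - ?d))
      \<le> (\<integral>x. ?c * (indicator ?S x * (1 / w (norm x) * norm x powr (1 - ?d))) \<partial>lborel)"
      unfolding set_lebesgue_integral_def
    proof (rule integral_mono')
      show "integrable lborel (\<lambda>x. ?c * (indicator ?S x * (1 / w (norm x) * norm x powr (1 - ?d))))"
        by (intro integrable_mult_right int(1))
      fix x :: 'a
      have pos: "0 \<le> 1 / w (norm x)" if "x \<in> ?S"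
        using wn[of "norm x"] that by auto
      then show nn: "0 \<le> ?c * (indicator ?S x * (1 / w (norm x) * norm x powr (1 - ?d)))"
        by (auto simp: indicator_def)
      show "indicator (ball 0 \<eta>) x *\<^sub>R (norm (gradient u x) powr p * w (norm x) powr (p - 1)
        * norm x powr (1 - ?d)) \<le> ?c * (indicator ?S x * (1 / w (norm x) * norm x powr (1 - ?d)))"
      proof (cases "x \<in> ?S")
        case False
        then have "gradient u x = 0" by (intro grad0) (auto simp: An_def)
        then show ?thesis using nn p by simp
      next
        case True
        then have x: "x \<in> An" "x \<in> ball 0 \<eta>" using ab by (auto simp: An_def)
        have wx: "0 < w (norm x)" using wn True by auto
        have "norm (gradient u x) powr p \<le> (4 * K / F * (1 / w (norm x))) powr p"
          using grad[OF x(1)] p by (intro powr_mono2) auto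
        also have "\<dots> = ?c * (1 / w (norm x)) powr p"
          using b'(3) F wx by (subst powr_mult) auto
        finally have "norm (gradient u x) powr p * w (norm x) powr (p - 1)
            \<le> ?c * (1 / w (norm x)) powr p * w (norm x) powr (p - 1)"
          by (intro mult_right_mono) auto
        also have "\<dots> = ?c * (1 / w (norm x))"
          using wx by (simp add: powr_diff powr_divide)
        finally have "norm (gradient u x) powr p * w (norm x) powr (p - 1) * norm x powr (1 - ?d)
            \<le> ?c * (1 / w (norm x)) * norm x powr (1 - ?d)"
          by (intro mult_right_mono) auto
        then show ?thesis using True x(2) by (simp add: mult.assoc)
      qed
    qed
    also have "\<dots> = ?c * (DIM('a) * cone_vol e (32 * \<epsilon>) * F)"
      unfolding integral_mult_right_zero int(2) \<Phi>F ..
    also have "\<dots> = (4 * K) powr p * DIM('a) * F powr (1 - p) * cone_vol e (32 * \<epsilon>)"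
      using F b'(3) by (simp add: powr_divide powr_diff)
    finally show ?thesis .
  qed
  have lower: "exp (-16) powr q * 2 powr (- (1 + s)) * DIM('a) / 4 * F powr (- s) * cone_vol e \<epsilon>
      \<le> (LINT x:ball 0 \<eta>|lborel. \<bar>u x\<bar> powr q * norm x powr (1 - ?d)
          / (w (norm x) * ?f (norm x) powr (1 + s)))" (is "_ \<le> (LINT x:_|lborel. ?J x)")
  proof -
    let ?S = "cone_at e \<epsilon> \<inter> {x. a' \<le> norm x \<and> norm x \<le> r'}"
    let ?c = "exp (-16) powr q * (2 * F) powr (- (1 + s))"
    have sub: "{a'..r'} \<subseteq> {a..b}" using a' by auto
    have a'0: "0 < a'" using a' ab by simp
    have d\<Phi>': "\<forall>r\<in>{a'..r'}. (\<Phi> has_real_derivative 1 / w r) (at r)"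
      using d\<Phi>_ball sub by blast
    note int = cone_annulus_integral[OF a'0 a'(2) continuous_on_subset[OF k(1) sub] d\<Phi>', of e \<epsilon>]
    have J0: "?J x = 0" if "x \<notin> An" for x
    proof -
      have "u x \<noteq> 0 \<Longrightarrow> a \<le> norm x \<and> norm x \<le> b"
        unfolding u_def by (rule test_fun_mem_test_functions(2)[OF ab(1-3) P]; assumption)
      then show ?thesis using that q by (auto simp: An_def)
    qed
    have cAn: "compact An"
    proof -
      have "closed An" unfolding An_def
        by (intro closed_Collect_conj closed_Collect_le continuous_intros)
      moreover have "bounded An"
        by (rule bounded_subset[OF bounded_cball[of 0 b]]) (auto simp: An_def)
      ultimately show ?thesis by (simp add: compact_eq_bounded_closed)
    qed
    have fpos: "0 < ?f (norm x)" "0 < w (norm x)" "0 < norm x" if "x \<in> An" for x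
      using rng[OF An(1)[OF that]] wn[OF An(1)[OF that]] F that ab
      unfolding An_def mem_Collect_eq by linarith+
    have "continuous_on UNIV u" using Ck_test_fun[of 0] by (simp add: u_def)
    then have cu: "continuous_on An u" using continuous_on_subset by blast
    have cont_norm: "continuous_on An (\<lambda>x. g (norm x))" if "\<And>r. 0 < r \<Longrightarrow> isCont g r" for g :: "real \<Rightarrow> real"
      by (rule continuous_on_compose2[of "{0<..}" g])
        (use that fpos in \<open>auto intro!: continuous_at_imp_continuous_on continuous_intros\<close>)
    have cf: "isCont ?f r" if "0 < r" for r
    proof -
      have "isCont (\<lambda>r. \<sigma> * (\<sigma> * ?f r)) r"
        by (rule isCont_mult[OF continuous_const DERIV_isCont[OF \<Phi>(1)[OF that]]])
      moreover have "\<sigma> * (\<sigma> * y) = y" for y using \<sigma> by auto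
      ultimately show ?thesis by (simp only:)
    qed
    have c1: "continuous_on An (\<lambda>x. \<bar>u x\<bar> powr q)"
      by (rule continuous_on_powr'[OF continuous_on_rabs[OF cu] continuous_on_const]) (use q in simp)
    have c2: "continuous_on An (\<lambda>x. norm x powr (1 - ?d))"
      by (rule cont_norm) (intro continuous_intros, simp)
    have c3: "continuous_on An (\<lambda>x. w (norm x))"
      by (rule cont_norm) (rule weights_isCont[OF w])
    have c4: "continuous_on An (\<lambda>x. ?f (norm x) powr (1 + s))"
    proof (rule continuous_on_powr[OF _ continuous_on_const])
      show "continuous_on An (\<lambda>x. ?f (norm x))" by (rule cont_norm) (rule cf)
      show "\<forall>x\<in>An. ?f (norm x) \<noteq> 0" by (metis fpos(1) less_irrefl)
    qed
    have nz: "\<forall>x\<in>An. w (norm x) * ?f (norm x) powr (1 + s) \<noteq> 0"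
    proof
      fix x assume "x \<in> An"
      from fpos(1,2)[OF this] show "w (norm x) * ?f (norm x) powr (1 + s) \<noteq> 0" by simp
    qed
    have "continuous_on An ?J"
      by (rule continuous_on_divide[OF continuous_on_mult[OF c1 c2] continuous_on_mult[OF c3 c4] nz])
    from borel_integrable_compact[OF cAn this]
    have intJ: "integrable lborel (\<lambda>x. indicator An x *\<^sub>R ?J x)" .
    have JAn: "(LINT x:ball 0 \<eta>|lborel. ?J x) = (\<integral>x. indicator An x *\<^sub>R ?J x \<partial>lborel)"
      unfolding set_lebesgue_integral_def
    proof (intro Bochner_Integration.integral_cong refl)
      show "indicator (ball 0 \<eta>) x *\<^sub>R ?J x = indicator An x *\<^sub>R ?J x" for x
      proof (cases "x \<in> An")
        case True
        then have "x \<in> ball 0 \<eta>" using ab by (simp add: An_def)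
        then show ?thesis using True by simp
      next
        case False
        then show ?thesis using J0[OF False] by simp
      qed
    qed
    have "exp (-16) powr q * 2 powr (- (1 + s)) * DIM('a) / 4 * F powr (- s) * cone_vol e \<epsilon>
        = ?c * (DIM('a) * cone_vol e \<epsilon> * (F / 4))"
    proof -
      define T G where "T = 2 powr (- (1 + s))" and "G = F powr (- (1 + s))"
      have "(2 * F) powr (- (1 + s)) = T * G" unfolding T_def G_def using F by (subst powr_mult) auto
      moreover have "F powr (- s) = G * F"
        unfolding G_def using powr_add[of F "- (1 + s)" 1] F by simp
      ultimately show ?thesis unfolding T_def[symmetric] by simp
    qed
    also have "\<dots> \<le> ?c * (DIM('a) * cone_vol e \<epsilon> * (\<Phi> r' - \<Phi> a'))"
      using a'(4) by (intro mult_left_mono) (auto simp: cone_vol_nonneg)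
    also have "\<dots> = (\<integral>x. ?c * (indicator ?S x * (1 / w (norm x) * norm x powr (1 - ?d))) \<partial>lborel)"
      unfolding integral_mult_right_zero int(2) ..
    also have "\<dots> \<le> (\<integral>x. indicator An x *\<^sub>R ?J x \<partial>lborel)"
    proof (rule integral_mono')
      show "integrable lborel (\<lambda>x. indicator An x *\<^sub>R ?J x)" by (rule intJ)
      fix x :: 'a
      show nn: "0 \<le> indicator An x *\<^sub>R ?J x"
      proof (cases "x \<in> An")
        case True
        have "0 \<le> ?J x"
          using fpos[OF True] by (intro divide_nonneg_nonneg mult_nonneg_nonneg) auto
        then show ?thesis using True by simp
      qed simp
      show "?c * (indicator ?S x * (1 / w (norm x) * norm x powr (1 - ?d))) \<le> indicator An x *\<^sub>R ?J x"
      proof (cases "x \<in> ?S")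
        case False
        then show ?thesis using nn by simp
      next
        case True
        then have x: "x \<in> An" and r: "norm x \<in> {a'..r'}" using a' by (auto simp: An_def)
        have "norm (x - a *\<^sub>R e) \<le> norm (x - norm x *\<^sub>R e) + \<bar>norm x - a\<bar>"
          using norm_diff_axis_le(3)[OF e, of a x] ab by simp
        also have "\<dots> \<le> \<epsilon> * norm x + (b - a)" using True r a' by (intro add_mono) (auto simp: cone_at_def)
        also have "\<dots> \<le> \<epsilon> * (2 * a) + 2 * \<epsilon> * a"
          using r a' b2a \<epsilon> ab(4) by (intro add_mono mult_left_mono) auto
        also have "\<dots> = \<delta> / 4" by (simp add: \<delta>_def)
        finally have ux: "exp (-16) \<le> u x"
          unfolding u_def using Pm[OF r] An(2)[OF x] \<delta> by (intro test_fun_ge) auto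
        then have "0 < u x" using exp_gt_zero less_le_trans by blast
        have 1: "exp (-16) powr q \<le> \<bar>u x\<bar> powr q"
          using ux \<open>0 < u x\<close> q by (intro powr_mono2) auto
        have 2: "(2 * F) powr (- (1 + s)) \<le> ?f (norm x) powr (- (1 + s))"
          using rng[OF An(1)[OF x]] fpos[OF x] s by (intro powr_mono2') auto
        have "?c \<le> \<bar>u x\<bar> powr q * ?f (norm x) powr (- (1 + s))"
          using 1 2 by (intro mult_mono) auto
        then have "?c * (1 / w (norm x) * norm x powr (1 - ?d))
            \<le> \<bar>u x\<bar> powr q * ?f (norm x) powr (- (1 + s)) * (1 / w (norm x) * norm x powr (1 - ?d))"
          using fpos[OF x] by (intro mult_right_mono) auto
        also have "\<dots> = ?J x"
          unfolding powr_minus[of _ "1 + s"] by (simp add: divide_inverse mult_ac)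
        finally show ?thesis using True x by simp
      qed
    qed
    finally show ?thesis unfolding JAn .
  qed
  show thesis by (rule that[OF u F upper lower])
qed

section \<open>Failure of the inequality\<close>

text \<open>Inserting the test functions into the inequality: the powers of \<open>F\<close> cancel, since
  \<open>q / p' * (p / q) = p - 1\<close>, and a positive power of the volume of the cones remains on the right.\<close>

lemma cone_vol_ratio_bound:
  fixes p q \<mu> \<eta> :: real and w :: "real \<Rightarrow> real"
  assumes pq: "1 < p" "p < q" and \<mu>: "0 < \<mu>" "0 < \<eta>" and w: "w \<in> weights"
    and H: "(H \<mu> \<eta> w \<longlongrightarrow> 0) (at_right 0)" and C: "0 < C"
    and ineq: "\<forall>u \<in> test_functions (ball (0 :: 'a::euclidean_space) \<eta> - {0}).
           (LINT x:ball 0 \<eta>|lborel.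
              norm (gradient u x) powr p * w (norm x) powr (p - 1)
                * norm x powr (1 - real DIM('a)))
           \<ge> C * (LINT x:ball 0 \<eta>|lborel.
              \<bar>u x\<bar> powr q * norm x powr (1 - real DIM('a))
                / (w (norm x) * f_eta \<mu> \<eta> w (norm x) powr (1 + q / (p / (p - 1))))) powr (p / q)"
  obtains c0 c1 where "0 < c0"
    "\<And>\<epsilon>. 0 < \<epsilon> \<Longrightarrow> \<epsilon> \<le> 1 / 2 \<Longrightarrow> c0 \<le> c1 * (\<epsilon> ^ (DIM('a) - 1)) powr (1 - p / q)"
proof -
  let ?d = "DIM('a)"
  obtain e :: 'a where e: "norm e = 1" using vector_choose_size[of 1] by auto
  obtain b' K where b': "\<And>t. (bump has_real_derivative b' t) (at t)" "\<And>t. \<bar>b' t\<bar> \<le> K" "1 \<le> K"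
      "\<And>t. t \<le> 0 \<or> 1 \<le> t \<Longrightarrow> b' t = 0"
    by (rule bump_derivative) (rule that; assumption)
  define s where "s = q / (p / (p - 1))"
  have s: "0 < s" using pq by (simp add: s_def)
  define A where "A = (4 * K) powr p * ?d"
  define B where "B = exp (-16) powr q * 2 powr (- (1 + s)) * ?d / 4"
  define V0 where "V0 = unit_ball_vol ?d / (8 ^ ?d * ?d)"
  define V1 where "V1 = unit_ball_vol ?d * (32 + 1) ^ ?d"
  have pos: "0 < A" "0 < B" "0 < V0" "0 < V1"
    using b'(3) by (auto simp: A_def B_def V0_def V1_def)
  show thesis
  proof
    show "0 < C * (B * V0) powr (p / q)" using pos C by simp
    fix \<epsilon> :: real assume \<epsilon>: "0 < \<epsilon>" "\<epsilon> \<le> 1 / 2"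
    define x where "x = \<epsilon> ^ (?d - 1)"
    have x: "0 < x" using \<epsilon> by (simp add: x_def)
    have "0 < q" using pq by simp
    obtain u :: "'a \<Rightarrow> real" and F where u: "u \<in> test_functions (ball 0 \<eta> - {0})" and F: "0 < F"
      and I: "(LINT x:ball 0 \<eta>|lborel. norm (gradient u x) powr p * w (norm x) powr (p - 1)
        * norm x powr (1 - real ?d)) \<le> A * F powr (1 - p) * cone_vol e (32 * \<epsilon>)"
      and J: "B * F powr (- s) * cone_vol e \<epsilon>
        \<le> (LINT x:ball 0 \<eta>|lborel. \<bar>u x\<bar> powr q * norm x powr (1 - real ?d)
          / (w (norm x) * f_eta \<mu> \<eta> w (norm x) powr (1 + s)))" (is "_ \<le> ?J")
      by (rule test_function_estimate[OF w \<mu> H \<epsilon> e pq(1) \<open>0 < q\<close> s b'(1-3)],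
          rule b'(4), assumption, (rule that; (assumption | (unfold A_def B_def, assumption))))
    have "(B * V0) * (x * F powr (- s)) = B * F powr (- s) * (V0 * x)" by simp
    also have "\<dots> \<le> B * F powr (- s) * cone_vol e \<epsilon>"
      using cone_vol_ge[OF e \<epsilon>] pos unfolding x_def V0_def by (intro mult_left_mono) auto
    also note J
    finally have J': "((B * V0) * (x * F powr (- s))) powr (p / q) \<le> ?J powr (p / q)"
      using pos x pq by (intro powr_mono2) auto
    have "(F powr (- s)) powr (p / q) = F powr (1 - p)"
      using pq by (simp add: powr_powr s_def)
    then have "C * ((B * V0) powr (p / q) * (x powr (p / q) * F powr (1 - p)))
        = C * ((B * V0) * (x * F powr (- s))) powr (p / q)"
      using pos x F by (simp add: powr_mult)
    also have "\<dots> \<le> C * ?J powr (p / q)" using J' C by (intro mult_left_mono) auto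
    also have "\<dots> \<le> A * F powr (1 - p) * cone_vol e (32 * \<epsilon>)"
      using bspec[OF ineq u] I unfolding s_def by (rule order_trans)
    also have "\<dots> \<le> A * F powr (1 - p) * (V1 * x)"
      using cone_vol_le[OF e \<epsilon>, of 32] pos unfolding x_def V1_def by (intro mult_left_mono) auto
    finally have "C * (B * V0) powr (p / q) * (x powr (p / q) * F powr (1 - p))
        \<le> A * V1 * x * F powr (1 - p)" by (simp add: mult_ac)
    also have "A * V1 * x * F powr (1 - p)
        = A * V1 * x powr (1 - p / q) * (x powr (p / q) * F powr (1 - p))"
    proof -
      have "x powr (1 - p / q) * x powr (p / q) = x" using x by (simp add: powr_add[symmetric])
      then show ?thesis by (metis mult.assoc)
    qed
    finally have "C * (B * V0) powr (p / q) * (x powr (p / q) * F powr (1 - p))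
        \<le> A * V1 * x powr (1 - p / q) * (x powr (p / q) * F powr (1 - p))" by (simp only: mult.assoc)
    then show "C * (B * V0) powr (p / q) \<le> A * V1 * (\<epsilon> ^ (?d - 1)) powr (1 - p / q)"
      unfolding x_def[symmetric] by (rule mult_right_le_imp_le) (use x F in simp)
  qed
qed

theorem theorem3p2:
  fixes p q \<mu> \<eta> :: real and w :: "real \<Rightarrow> real"
  assumes "CARD('n::finite) > 1"
    and "1 < p" and "p < q" and "\<mu> > 0"
    and "0 \<le> 1 / p - 1 / q" and "1 / p - 1 / q \<le> 1 / real CARD('n)"
    and "\<eta> > 0"
    and "w \<in> weights"
    and "(H \<mu> \<eta> w \<longlongrightarrow> 0) (at_right 0)"
  shows "\<not> (\<exists>C>0. \<forall>u \<in> test_functions (ball (0 :: real ^ 'n) \<eta> - {0}).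
           (LINT x:ball 0 \<eta>|lborel.
              norm (gradient u x) powr p * w (norm x) powr (p - 1)
                * norm x powr (1 - real CARD('n)))
           \<ge> C * (LINT x:ball 0 \<eta>|lborel.
              \<bar>u x\<bar> powr q * norm x powr (1 - real CARD('n))
                / (w (norm x) * f_eta \<mu> \<eta> w (norm x) powr (1 + q / (p / (p - 1))))) powr (p / q))"
proof
  have dim: "CARD('n) = DIM(real ^ 'n)" by simp
  assume "\<exists>C>0. \<forall>u \<in> test_functions (ball (0 :: real ^ 'n) \<eta> - {0}).
           (LINT x:ball 0 \<eta>|lborel.
              norm (gradient u x) powr p * w (norm x) powr (p - 1)
                * norm x powr (1 - real CARD('n)))
           \<ge> C * (LINT x:ball 0 \<eta>|lborel.
              \<bar>u x\<bar> powr q * norm x powr (1 - real CARD('n))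
                / (w (norm x) * f_eta \<mu> \<eta> w (norm x) powr (1 + q / (p / (p - 1))))) powr (p / q)"
  then obtain C where C: "0 < C" and ineq: "\<forall>u \<in> test_functions (ball (0 :: real ^ 'n) \<eta> - {0}).
           (LINT x:ball 0 \<eta>|lborel.
              norm (gradient u x) powr p * w (norm x) powr (p - 1)
                * norm x powr (1 - real DIM(real ^ 'n)))
           \<ge> C * (LINT x:ball 0 \<eta>|lborel.
              \<bar>u x\<bar> powr q * norm x powr (1 - real DIM(real ^ 'n))
                / (w (norm x) * f_eta \<mu> \<eta> w (norm x) powr (1 + q / (p / (p - 1))))) powr (p / q)"
    unfolding dim by blast
  obtain c0 c1 where c0: "0 < c0" and
    le: "\<And>\<epsilon>. 0 < \<epsilon> \<Longrightarrow> \<epsilon> \<le> 1 / 2 \<Longrightarrow> c0 \<le> c1 * (\<epsilon> ^ (DIM(real ^ 'n) - 1)) powr (1 - p / q)"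
    by (rule cone_vol_ratio_bound[OF assms(2-4,7-9) C ineq]) (rule that; assumption)
  have "((\<lambda>\<epsilon>::real. \<epsilon> ^ (CARD('n) - 1)) \<longlongrightarrow> 0 ^ (CARD('n) - 1)) (at_right 0)"
    by (intro tendsto_intros)
  then have "((\<lambda>\<epsilon>::real. \<epsilon> ^ (CARD('n) - 1)) \<longlongrightarrow> 0) (at_right 0)"
    using assms(1) by (simp add: power_0_left)
  moreover have "\<forall>\<^sub>F \<epsilon> in at_right (0::real). 0 \<le> \<epsilon> ^ (CARD('n) - 1)"
    using eventually_at_right_less[of "0::real"] by eventually_elim simp
  moreover have "0 < 1 - p / q" using assms(2,3) by simp
  ultimately have "((\<lambda>\<epsilon>::real. c1 * (\<epsilon> ^ (CARD('n) - 1)) powr (1 - p / q)) \<longlongrightarrow> c1 * 0 powr (1 - p / q))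
      (at_right 0)"
    by (intro tendsto_mult tendsto_const tendsto_powr') auto
  moreover have "\<forall>\<^sub>F \<epsilon> in at_right (0::real). \<epsilon> \<in> {0<..<1 / 2}"
    by (rule eventually_at_right_real) simp
  then have "\<forall>\<^sub>F \<epsilon> in at_right 0. c0 \<le> c1 * (\<epsilon> ^ (CARD('n) - 1)) powr (1 - p / q)"
    by eventually_elim (use le in simp)
  ultimately have "c0 \<le> c1 * 0 powr (1 - p / q)"
    by (rule tendsto_lowerbound) simp
  then show False using c0 by simp
qed

end
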